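(* For each $i\in\mathcal N$ let $\mathcal X_i\subset\mathbb R^{m_i}$ be a closed and compact convex set and let $r_i$ be its indicator function ($0$ on $\mathcal X_i$, $+\infty$ elsewhere). Assume the following for every $i\in\mathcal N$. (1) For every fixed $x_{-i}\in\prod_{j\ne i}\mathcal X_j$ the map $x_i\mapsto f_i(x_i,h_i(x_i)+\sigma(x_{-i}))$ is convex on $\mathcal X_i$; and $f_i$ is continuously differentiable in $(x_i,\sigma)$ on an open set containing $\mathcal X_i\times\mathbb R^m$. (2) $\phi$ is Lipschitz continuous and monotone on $\mathcal X=\prod_{i=1}^N\mathcal X_i$. (3) $h_i$ is $L_{hi}$-Lipschitz on $\mathcal X_i$; and for every $c_z>0$ there is a constant $L_{fi}$ (possibly depending on $c_z$) such that $\|F_i(x_i,z_1)-F_i(x_i,z_2)\|\le L_{fi}\|z_1-z_2\|$ for all $x_i\in\mathcal X_i$ and all $z_1,z_2\in\mathbb R^m$ with $\|z_1\|,\|z_2\|\le c_z$. (4) $\psi_i(\cdot,\cdot;\xi_i)$ is differentiable on $\mathcal C_i\times\mathbb R^m$ for every fixed $\xi_i\in\mathbb R^{d_i}$, where $\mathcal C_i$ is an open set containing $\mathcal X_i$; and for all $x_i\in\mathcal X_i$, $z_i\in\mathbb R^m$, $\xi_i\in\mathbb R^{d_i}$, $\mathbb E[q_i(x_i,z_i;\xi_i)\mid x_i]=F_i(x_i,z_i)$ and $\|q_i(x_i,z_i;\xi_i)-F_i(x_i,z_i)\|\le\upsilon_i$ for some $\upsilon_i>0$. (5) $W_k$ is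 doubly stochastic for all $k\ge0$; there is $\varsigma\in(0,1)$ with $\omega_{ij,k}\ge\varsigma$ for all $k\ge 0$, $i\in\mathcal N$, $j\in\mathcal N_{i,k}$; and there is a positive integer $P$ such that the graph $(\mathcal N,\bigcup_{l=1}^P\mathcal E_{k+l})$ is strongly connected for every $k\ge0$. For each $i$ set $\alpha_{i,k}=(k+\lambda_i)^{-a}$ and $\eta_{i,k}=(k+\delta_i)^{-b}$ for some $\lambda_i>0,\delta_i>0$, with $a\in(1/2,1)$, $a>b>0$ and $a+b<1$. Let $\hat x_K$ be the averaged sequence of the algorithm described in the context. Then for any given $\epsilon_1,\epsilon_2\in(0,1]$ there exist positive constants $C_{g1}',C_{g2}',C_{g3}',C_{g4}'$ such that for any positive integer $K$, $$\mathbb P\Big(G(\hat x_K)\ge\big(C_{g1}'+C_{g3}'\sqrt{\ln(1/\epsilon_1)}+C_{g4}'\sqrt{\ln(1/\epsilon_2)}\big)K^{a-1}+C_{g2}'K^{-b}\Big)\le\epsilon_1+\epsilon_2 .$$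
   Context: Game. There are $N$ players, $\mathcal N=\{1,\dots,N\}$; player $i$ controls $x_i\in\mathbb R^{m_i}$, $m=\sum_i m_i$, $x=(x_1,\dots,x_N)$, $x_{-i}=(x_j)_{j\ne i}$. The functions $h_j:\mathbb R^{m_j}\to\mathbb R^m$ are continuously differentiable, $\sigma(x)=\sum_{j=1}^N h_j(x_j)$ and $\sigma(x_{-i})=\sum_{j\ne i}h_j(x_j)$. Given $x_{-i}$, player $i$ minimizes $f_i(x_i,h_i(x_i)+\sigma(x_{-i}))+r_i(x_i)$ over $x_i$, where $f_i(x_i,s)=\mathbb E[\psi_i(x_i,s;\xi_i)]$, $\xi_i$ is an $\mathbb R^{d_i}$-valued random variable and $\psi_i:\mathbb R^{m_i}\times\mathbb R^m\times\mathbb R^{d_i}\to\mathbb R$. Maps. $F_i(x_i,z_i)=\big(\nabla_{x_i}f_i(x_i,\sigma)+\nabla h_i(x_i)\nabla_\sigma f_i(x_i,\sigma)\big)\big|_{\sigma=z_i}$ ($\nabla h_i$ is the transposed Jacobian), $\phi_i(x)=F_i(x_i,\sigma(x))$, $\phi=(\phi_1,\dots,\phi_N)$, and $q_i(x_i,z_i;\xi_i)=\big(\nabla_{x_i}\psi_i(x_i,\sigma;\xi_i)+\nabla h_i(x_i)\nabla_\sigma\psi_i(x_i,\sigma;\xi_i)\big)\big|_{\sigma=z_i}$. "Monotone on $\mathcal X$" means $(\phi(x)-\phi(x'))^T(x-x')\ge0$ for all $x,x'\in\mathcal X$. $\|\cdot\|$ is the Euclidean norm. Gap function: $G(x)=\sup_{y\in\mathcal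 X}(x-y)^T\phi(y)$ for $x\in\mathcal X$. Network. At time $k$, players communicate over a digraph $\mathcal G_k=(\mathcal N,\mathcal E_k)$, $(j,i)\in\mathcal E_k$ meaning $i$ receives information from $j$; $\mathcal N_{i,k}=\{j:(j,i)\in\mathcal E_k\}$, and $i\in\mathcal N_{i,k}$. $W_k=[\omega_{ij,k}]$ is the nonnegative matrix with $\omega_{ij,k}>0$ iff $(j,i)\in\mathcal E_k$, and $\omega_{ij,k}=0$ otherwise. Algorithm. Start with $x_{i,0}\in\mathcal X_i$, $v_{i,0}=h_i(x_{i,0})$. For $k=0,1,2,\dots$ and each $i$: $\hat v_{i,k}=\sum_{j\in\mathcal N_{i,k}}\omega_{ij,k}v_{j,k}$; $x_{i,k+1}=\Pi_{\mathcal X_i}\big(x_{i,k}-\alpha_{i,k}(q_i(x_{i,k},N\hat v_{i,k};\xi_{i,k})+\eta_{i,k}x_{i,k})\big)$ with $\Pi_{\mathcal X_i}$ the Euclidean projection; $v_{i,k+1}=\hat v_{i,k}+h_i(x_{i,k+1})-h_i(x_{i,k})$. Here $\xi_{i,k}$ is a fresh realization of $\xi_i$ at time $k$; with $\zeta_{i,k}=q_i(x_{i,k},N\hat v_{i,k};\xi_{i,k})-F_i(x_{i,k},N\hat v_{i,k})$ and $\mathcal F_k$ the $\sigma$-algebra generated by $x_0$ and $\zeta_{i,l}$, $i\in\mathcal N$, $0\le l\le k-1$, the sampling is such that $\mathbb E[\zeta_{i,k}\mid\mathcal F_k]=0$ and $\|\zeta_{i,k}\|\le\upsilon_i$. Averaged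 sequence: $x_k=(x_{1,k},\dots,x_{N,k})$, $\alpha_{\max,k}=\max_i\alpha_{i,k}$, $\hat x_K=\frac{\sum_{p=0}^{K-1}\alpha_{\max,p}x_p}{\sum_{p=0}^{K-1}\alpha_{\max,p}}$. *)

theory Defs
  imports "HOL-Probability.Probability"
begin

text \<open>
  Player-dependent dimensions. The coordinates of the joint space $R^m$, $m = \sum_i m_i$, are
  indexed by a finite type, and a map \<open>own\<close> tells which player owns which coordinate, so that
  $m_i$ is the number of coordinates with owner \<open>i\<close>. The space $R^{m_i}$ of player \<open>i\<close> is the
  coordinate subspace \<open>block own i\<close>. It carries the Euclidean norm, inner product and topology of
  $R^{m_i}$, and a joint vector is the stacking of its blocks. The sample spaces $R^{d_i}$ are
  treated in the same way, with their own index type and owner map.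
\<close>

definition block :: "('c \<Rightarrow> 'n) \<Rightarrow> 'n \<Rightarrow> (real^'c::finite) set" where
  "block own i = {v. \<forall>c. own c \<noteq> i \<longrightarrow> v $ c = 0}"

definition block_part :: "('c \<Rightarrow> 'n) \<Rightarrow> 'n \<Rightarrow> real^'c::finite \<Rightarrow> real^'c" where
  "block_part own i x = (\<chi> c. if own c = i then x $ c else 0)"

definition stack :: "('c \<Rightarrow> 'n) \<Rightarrow> ('n \<Rightarrow> real^'c::finite) \<Rightarrow> real^'c" where
  "stack own u = (\<chi> c. u (own c) $ c)"

definition joint_set :: "('c \<Rightarrow> 'n) \<Rightarrow> ('n \<Rightarrow> (real^'c::finite) set) \<Rightarrow> (real^'c) set" where
  "joint_set own X = {x. \<forall>i. block_part own i x \<in> X i}"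

text \<open>
  A function on $R^{m_i}$ is a function on \<open>block own i\<close>; its values elsewhere are never used.
  Smoothness of \<open>g\<close> on $R^{m_i}$ is smoothness of \<open>g \<circ> block_part own i\<close> on the full space. The gradient
  of this composition at a point of the block is the gradient of \<open>g\<close>, padded with zeros on the
  coordinates of the other players.

  \<open>C1_on U g\<close> is only meant for open \<open>U\<close>.
\<close>

definition C1_on :: "'a::real_normed_vector set \<Rightarrow> ('a \<Rightarrow> 'b::real_normed_vector) \<Rightarrow> bool" where
  "C1_on U g \<longleftrightarrow> (\<exists>g' :: 'a \<Rightarrow> 'a \<Rightarrow>\<^sub>L 'b.
     (\<forall>x\<in>U. (g has_derivative blinfun_apply (g' x)) (at x)) \<and> continuous_on U g')"

definition grad :: "(real^'c::finite \<Rightarrow> real) \<Rightarrow> real^'c \<Rightarrow> real^'c" where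
  "grad g x = (\<chi> c. frechet_derivative g (at x) (axis c 1))"

text \<open>
  \<open>total_grad own i h g u z\<close> is $(\nabla_{u} g(u,\sigma) + \nabla h(u) \nabla_\sigma g(u,\sigma))$ at
  $\sigma = z$, where $\nabla h$ is the transposed Jacobian: the derivative of
  $u \mapsto g(u, h(u) + c)$ with the second argument replaced by \<open>z\<close> after differentiation.
\<close>

definition total_grad ::
  "('c \<Rightarrow> 'n) \<Rightarrow> 'n \<Rightarrow> (real^'c \<Rightarrow> real^'c) \<Rightarrow> (real^'c \<Rightarrow> real^'c \<Rightarrow> real)
     \<Rightarrow> real^'c \<Rightarrow> real^'c \<Rightarrow> real^'c::finite" where
  "total_grad own i h g u z =
     grad (\<lambda>y. g (block_part own i y) z) u
     + transpose (jacobian (\<lambda>y. h (block_part own i y)) (at u)) *v grad (\<lambda>s. g u s) z"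

definition expected_cost ::
  "'w measure \<Rightarrow> ('u \<Rightarrow> 's \<Rightarrow> 'e \<Rightarrow> real) \<Rightarrow> ('w \<Rightarrow> 'e) \<Rightarrow> 'u \<Rightarrow> 's \<Rightarrow> real" where
  "expected_cost M psi xi u s = (\<integral>\<omega>. psi u s (xi \<omega>) \<partial>M)"

definition aggregate ::
  "('c \<Rightarrow> 'n) \<Rightarrow> ('n::finite \<Rightarrow> real^'c \<Rightarrow> real^'c) \<Rightarrow> real^'c \<Rightarrow> real^'c::finite" where
  "aggregate own h x = (\<Sum>j\<in>UNIV. h j (block_part own j x))"

definition aggregate_others ::
  "('c \<Rightarrow> 'n) \<Rightarrow> ('n::finite \<Rightarrow> real^'c \<Rightarrow> real^'c) \<Rightarrow> 'n \<Rightarrow> real^'c \<Rightarrow> real^'c::finite" where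
  "aggregate_others own h i x = (\<Sum>j\<in>UNIV - {i}. h j (block_part own j x))"

text \<open>The supremum is finite as soon as \<open>X\<close> is nonempty and compact and \<open>phi\<close> is continuous on \<open>X\<close>.\<close>

definition gap :: "'a::real_inner set \<Rightarrow> ('a \<Rightarrow> 'a) \<Rightarrow> 'a \<Rightarrow> real" where
  "gap X phi x = (SUP y\<in>X. (x - y) \<bullet> phi y)"

definition past_algebra ::
  "'w measure \<Rightarrow> ('w \<Rightarrow> 'a::topological_space) \<Rightarrow> ('n \<Rightarrow> nat \<Rightarrow> 'w \<Rightarrow> 'b::topological_space)
     \<Rightarrow> nat \<Rightarrow> 'w measure" where
  "past_algebra M x0 zeta k = sigma (space M)
     ({x0 -` A \<inter> space M | A. A \<in> sets borel}
      \<union> {zeta i l -` A \<inter> space M | i l A. l < k \<and> A \<in> sets borel})"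

definition doubly_stochastic :: "real^'n^'n::finite \<Rightarrow> bool" where
  "doubly_stochastic W \<longleftrightarrow> (\<forall>i j. 0 \<le> W $ i $ j) \<and>
     (\<forall>i. (\<Sum>j\<in>UNIV. W $ i $ j) = 1) \<and> (\<forall>j. (\<Sum>i\<in>UNIV. W $ i $ j) = 1)"

definition strongly_connected :: "('n \<times> 'n) set \<Rightarrow> bool" where
  "strongly_connected E \<longleftrightarrow> (\<forall>i j. (i, j) \<in> E\<^sup>*)"

definition weighted_average :: "(nat \<Rightarrow> real) \<Rightarrow> (nat \<Rightarrow> 'a::real_vector) \<Rightarrow> nat \<Rightarrow> 'a" where
  "weighted_average w x K = (1 / (\<Sum>p<K. w p)) *\<^sub>R (\<Sum>p<K. w p *\<^sub>R x p)"

end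

(*
  Write x_k for the joint iterate and alpha_k for the largest step. The projection inequality summed
  over time and over the players gives, for every y in X,

    sum_k alpha_k (x_k - y) . phi(y)  <=  C + noise_K + C' K^(1-a-b)

  uniformly in y: monotonicity replaces phi(x_k) by phi(y), the regularization costs
  sum_k k^(-a-b), the spread between the players' steps telescopes, and the error of the aggregate
  estimates contributes sum_k alpha_k d_k, where d_k is the disagreement of the v_{i,k}. The
  disagreement contracts geometrically over a window of N P steps, while one step perturbs it by
  O(alpha_k); hence sum_k alpha_k d_k is bounded by a multiple of sum_k alpha_k^2, finite as a > 1/2.
  Dividing by sum_{k<K} alpha_k >= c K^(1-a) bounds the gap.

  The dependence of the noise on y is linear, so noise_K is dominated by |sum alpha x.zeta| plus a
  multiple of the coordinates of |sum alpha zeta|: finitely many martingales whose second moments are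
  bounded by a multiple of sum_k alpha_k^2. The constants may depend on the confidence levels, so
  Markov's inequality suffices.
*)
theory Submission
  imports Defs
begin

section \<open>Averaging over time-varying graphs\<close>

text \<open>Two orders of choice shape the proof. \<open>F i\<close> is Lipschitz in its second
  argument only on bounded sets, so no bound on the search direction is available until the
  estimates are known to be bounded. The disagreement is therefore bounded twice: first crudely,
  from compactness of the strategy sets alone, which fixes the radius for the Lipschitz constant;
  only afterwards with perturbations proportional to the steps. Secondly, the maximiser y in the gap
  depends on the sample path, so every constant has to precede both the path and y. For this reason
  the deterministic estimates are stated for an arbitrary \<open>run\<close>, with the noise treated
  as any bounded sequence, and randomness enters the gap bound only through \<open>noise\<close>.
  Disagreement is measured by coordinatewise ranges, because averaging with the rows of
  \<open>W k\<close> contracts ranges without any symmetry of the graphs; the columns conserve the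
  sum, which identifies the common value with the aggregate.\<close>

definition spread :: "('n::finite \<Rightarrow> real) \<Rightarrow> real" where
  "spread u = Max (range u) - Min (range u)"

lemma diff_le_spread: "u i - u j \<le> spread u"
proof -
  have "u i \<le> Max (range u)" "Min (range u) \<le> u j" by auto
  then show ?thesis unfolding spread_def by linarith
qed

lemma spread_nonneg: "0 \<le> spread u"
  using diff_le_spread[of u undefined undefined] by simp

lemma spread_leI:
  assumes "\<And>i j. u i - u j \<le> c"
  shows "spread u \<le> c"
proof -
  have "Max (range u) \<in> range u" "Min (range u) \<in> range u" by (auto intro!: Max_in Min_in)
  then obtain i j where "Max (range u) = u i" "Min (range u) = u j" by (metis rangeE)
  then show ?thesis using assms[of i j] unfolding spread_def by simp
qed

lemma spread_perturb:
  assumes "\<And>i. \<bar>w i - u i\<bar> \<le> c"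
  shows "spread w \<le> spread u + 2 * c"
proof (rule spread_leI)
  fix i j
  show "w i - w j \<le> spread u + 2 * c"
    using assms[of i] assms[of j] diff_le_spread[of u i j] by linarith
qed

text \<open>Applied to a path inside one connectivity window: the edge found is where a set of
  players grows.\<close>

lemma rtrancl_leaves_set:
  assumes "(i, j) \<in> E\<^sup>*" "i \<in> S" "j \<notin> S"
  shows "\<exists>k l. (k, l) \<in> E \<and> k \<in> S \<and> l \<notin> S"
  using assms by (induction rule: rtrancl_induct) blast+

text \<open>The rows alone contract ranges. Column sums, which conserve the total of the estimates,
  are added in \<open>aggregative_game\<close>.\<close>

locale averaging_network =
  fixes E :: "nat \<Rightarrow> ('n::finite \<times> 'n) set" and W :: "nat \<Rightarrow> real^'n^'n"
    and vsig :: real and P :: nat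
  assumes self_loop: "\<And>k i. (i, i) \<in> E k"
    and weight_nonneg: "\<And>k i j. 0 \<le> W k $ i $ j"
    and row_sum: "\<And>k i. (\<Sum>j\<in>UNIV. W k $ i $ j) = 1"
    and weight_lower: "\<And>k i j. (j, i) \<in> E k \<Longrightarrow> vsig \<le> W k $ i $ j"
    and vsig_pos: "0 < vsig" and vsig_less_1: "vsig < 1"
    and connected: "\<And>k. strongly_connected (\<Union>l\<in>{1..P}. E (k + l))"
begin

lemma rate_bounds: "0 < vsig ^ n" "vsig ^ n \<le> 1"
  using vsig_pos vsig_less_1 by (auto intro: power_le_one)

lemma average_le:
  assumes "\<And>j. u j \<le> b"
  shows "(\<Sum>j\<in>UNIV. W k $ i $ j * u j) \<le> b"
proof -
  have "(\<Sum>j\<in>UNIV. W k $ i $ j * u j) \<le> (\<Sum>j\<in>UNIV. W k $ i $ j * b)"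
    by (intro sum_mono mult_left_mono assms weight_nonneg)
  also have "\<dots> = b" by (simp add: sum_distrib_right[symmetric] row_sum)
  finally show ?thesis .
qed

lemma average_ge:
  assumes "\<And>j. b \<le> u j"
  shows "b \<le> (\<Sum>j\<in>UNIV. W k $ i $ j * u j)"
  using average_le[of "\<lambda>j. - u j" "- b" k i] assms by (simp add: sum_negf)

text \<open>The in-neighbour \<open>l\<close> has weight at least \<open>vsig\<close> and lies
  \<open>c\<close> below the cap, which lowers the average by at least \<open>vsig * c\<close>; all
  other terms are bounded by the cap.\<close>

lemma average_le_edge:
  assumes le: "\<And>j. u j \<le> b" and edge: "(l, i) \<in> E k" and ul: "u l \<le> b - c" and "0 \<le> c"
  shows "(\<Sum>j\<in>UNIV. W k $ i $ j * u j) \<le> b - vsig * c"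
proof -
  have "(\<Sum>j\<in>UNIV. W k $ i $ j * u j) = W k $ i $ l * u l + (\<Sum>j\<in>UNIV - {l}. W k $ i $ j * u j)"
    by (simp add: sum.remove)
  also have "\<dots> \<le> W k $ i $ l * (b - c) + (\<Sum>j\<in>UNIV - {l}. W k $ i $ j * b)"
    by (intro add_mono sum_mono mult_left_mono le ul weight_nonneg)
  also have "\<dots> = (\<Sum>j\<in>UNIV. W k $ i $ j * b) - W k $ i $ l * c"
    by (simp add: sum.remove[of UNIV l] algebra_simps)
  also have "\<dots> = b - W k $ i $ l * c"
    by (simp add: sum_distrib_right[symmetric] row_sum)
  also have "\<dots> \<le> b - vsig * c"
    using mult_right_mono[OF weight_lower[OF edge] \<open>0 \<le> c\<close>] by simp
  finally show ?thesis .
qed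

text \<open>The players holding a value at most \<open>b - vsig ^ t * (b - u 0 j)\<close> at time \<open>t\<close> form a set that
  never shrinks and that gains an element in every connectivity window until it is everything.\<close>

lemma window_upper_bound:
  assumes s: "s \<ge> 1" and le: "\<And>i. u 0 i \<le> b"
    and step: "\<And>t i. u (Suc t) i = (\<Sum>j\<in>UNIV. W (s + t) $ i $ j * u t j)"
  shows "u (CARD('n) * P) i \<le> b - vsig ^ (CARD('n) * P) * (b - u 0 j)"
proof -
  define c where "c = b - u 0 j"
  have c: "0 \<le> c" unfolding c_def using le[of j] by simp
  define R where "R t = {i. u t i \<le> b - vsig ^ t * c}" for t
  have ub: "u t i \<le> b" for t i
    by (induction t arbitrary: i) (auto simp: le step intro!: average_le)
  have edge: "i \<in> R (Suc t)" if "l \<in> R t" "(l, i) \<in> E (s + t)" for l i t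
  proof -
    have "u (Suc t) i \<le> b - vsig * (vsig ^ t * c)"
      unfolding step by (rule average_le_edge[OF ub that(2)])
        (use that c vsig_pos in \<open>auto simp: R_def\<close>)
    then show ?thesis by (simp add: R_def mult.assoc)
  qed
  \<comment> \<open>The threshold \<open>vsig ^ t * c\<close> shrinks by exactly the factor lost in
    \<open>edge\<close>, so the self-loop keeps every member in the set.\<close>
  have mono: "R t \<subseteq> R (t + r)" for t r
    by (induction r) (auto intro: edge self_loop)
  have grow: "R (n * P) = UNIV \<or> n + 1 \<le> card (R (n * P))" for n
  proof (induction n)
    case 0
    have "j \<in> R 0" by (simp add: R_def c_def)
    then have "card (R 0) > 0" by (auto simp: card_gt_0_iff)
    then show ?case by simp
  next
    case (Suc n)
    show ?case
    proof (cases "R (n * P) = UNIV")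
      case True
      then show ?thesis using mono[of "n * P" P] by (auto simp: add.commute)
    next
      case False
      then obtain l where l: "l \<notin> R (n * P)" by auto
      have "j \<in> R 0" by (simp add: R_def c_def)
      then have j: "j \<in> R (n * P)" using mono[of 0 "n * P"] by auto
      \<comment> \<open>Connectivity is stated for the graphs with indices k + 1 to k + P. The
        window that starts at \<open>s + n * P\<close> therefore has k one smaller, and
        \<open>s \<ge> 1\<close> makes this subtraction genuine.\<close>
      have "(j, l) \<in> (\<Union>l\<in>{1..P}. E ((s + n * P - 1) + l))\<^sup>*"
        using connected[of "s + n * P - 1"] unfolding strongly_connected_def by blast
      from rtrancl_leaves_set[OF this j l]
      obtain k i r where kir: "k \<in> R (n * P)" "i \<notin> R (n * P)" "r \<in> {1..P}"
        "(k, i) \<in> E ((s + n * P - 1) + r)" by blast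
      have "(k, i) \<in> E (s + (n * P + (r - 1)))" using kir(3,4) s
        by (metis (no_types, opaque_lifting) Nat.add_diff_assoc Nat.diff_add_assoc2 add.assoc
            atLeastAtMost_iff trans_le_add1)
      then have "i \<in> R (Suc (n * P + (r - 1)))"
        using edge mono[of "n * P" "r - 1"] kir(1) by blast
      moreover have "Suc (n * P + (r - 1)) + (P - r) = Suc n * P" using kir(3) by auto
      ultimately have "i \<in> R (Suc n * P)"
        using mono[of "Suc (n * P + (r - 1))" "P - r"] by (metis subsetD)
      then have "R (n * P) \<subset> R (Suc n * P)"
        using mono[of "n * P" P] kir(2) by (auto simp: add.commute)
      then have "card (R (n * P)) < card (R (Suc n * P))" by (simp add: psubset_card_mono)
      then show ?thesis using Suc False by linarith
    qed
  qed
  \<comment> \<open>Otherwise every one of the \<open>CARD('n)\<close> windows would have added a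
    player, which together with \<open>j\<close> gives more players than exist.\<close>
  have "R (CARD('n) * P) = UNIV"
  proof (rule ccontr)
    assume "R (CARD('n) * P) \<noteq> UNIV"
    then have "CARD('n) + 1 \<le> card (R (CARD('n) * P))" using grow[of "CARD('n)"] by simp
    moreover have "card (R (CARD('n) * P)) \<le> CARD('n)" by (intro card_mono) auto
    ultimately show False by simp
  qed
  then show ?thesis by (auto simp: R_def c_def)
qed

text \<open>With \<open>j\<close> a minimiser, the deficit in \<open>window_upper_bound\<close> is
  the whole spread: the maximum drops by that fraction of it, while the minimum never
  decreases.\<close>

lemma spread_window:
  assumes s: "s \<ge> 1"
    and step: "\<And>t i. u (Suc t) i = (\<Sum>j\<in>UNIV. W (s + t) $ i $ j * u t j)"
  shows "spread (u (CARD('n) * P)) \<le> (1 - vsig ^ (CARD('n) * P)) * spread (u 0)"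
proof (rule spread_leI)
  fix i l
  define b m where "b = Max (range (u 0))" and "m = Min (range (u 0))"
  have "m \<in> range (u 0)" unfolding m_def by (auto intro!: Min_in)
  then obtain j where j: "u 0 j = m" by auto
  have "u (CARD('n) * P) i \<le> b - vsig ^ (CARD('n) * P) * (b - u 0 j)"
    by (rule window_upper_bound[OF s _ step]) (simp_all add: b_def)
  moreover have "m \<le> u t l" for t l
    by (induction t arbitrary: l) (auto simp: m_def step intro!: average_ge)
  moreover have "spread (u 0) = b - m" by (simp add: spread_def b_def m_def)
  ultimately show "u (CARD('n) * P) i - u (CARD('n) * P) l \<le> (1 - vsig ^ (CARD('n) * P)) * spread (u 0)"
    unfolding j by (simp add: left_diff_distrib) (smt (verit))
qed

text \<open>Comparison with the unperturbed averaging \<open>u\<close> started from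
  \<open>w s\<close>. Row averages do not enlarge the sup norm, so the perturbations merely add up;
  the factor 2 arises because both ends of the range may move.\<close>

lemma spread_window_perturbed:
  assumes s: "s \<ge> 1" and p: "\<And>k i. \<bar>w (Suc k) i - (\<Sum>j\<in>UNIV. W k $ i $ j * w k j)\<bar> \<le> p k"
  shows "spread (w (s + CARD('n) * P)) \<le> (1 - vsig ^ (CARD('n) * P)) * spread (w s) + 2 * (\<Sum>r<CARD('n) * P. p (s + r))"
proof -
  define u where "u = rec_nat (w s) (\<lambda>t r i. \<Sum>j\<in>UNIV. W (s + t) $ i $ j * r j)"
  have u0: "u 0 = w s" and uS: "u (Suc t) i = (\<Sum>j\<in>UNIV. W (s + t) $ i $ j * u t j)" for t i
    by (simp_all add: u_def)
  have "\<bar>w (s + t) i - u t i\<bar> \<le> (\<Sum>r<t. p (s + r))" for t i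
  proof (induction t arbitrary: i)
    case 0
    then show ?case by (simp add: u0)
  next
    case (Suc t)
    let ?D = "\<Sum>j\<in>UNIV. W (s + t) $ i $ j * (w (s + t) j - u t j)"
    have "?D \<le> (\<Sum>r<t. p (s + r))" "- (\<Sum>r<t. p (s + r)) \<le> ?D"
      using Suc by (auto intro!: average_le average_ge simp: abs_le_iff) (smt (verit) Suc)
    moreover have "?D = (\<Sum>j\<in>UNIV. W (s + t) $ i $ j * w (s + t) j) - u (Suc t) i"
      by (simp add: uS sum_subtractf algebra_simps)
    ultimately show ?case using p[of "s + t" i] by (simp add: abs_le_iff)
  qed
  then have "spread (w (s + CARD('n) * P)) \<le> spread (u (CARD('n) * P)) + 2 * (\<Sum>r<CARD('n) * P. p (s + r))"
    by (rule spread_perturb)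
  then show ?thesis using spread_window[OF s uS] unfolding u0 by linarith
qed

text \<open>A single step need not contract, but averages stay within the old range. This serves the
  indices before the first full window.\<close>

lemma spread_step_perturbed:
  assumes p: "\<And>k i. \<bar>w (Suc k) i - (\<Sum>j\<in>UNIV. W k $ i $ j * w k j)\<bar> \<le> p k"
  shows "spread (w (Suc k)) \<le> spread (w k) + 2 * p k"
proof -
  have "(\<Sum>j\<in>UNIV. W k $ i $ j * w k j) \<le> Max (range (w k))" 
       "Min (range (w k)) \<le> (\<Sum>j\<in>UNIV. W k $ i $ j * w k j)" for i
    by (auto intro!: average_le average_ge)
  then have "spread (\<lambda>i. \<Sum>j\<in>UNIV. W k $ i $ j * w k j) \<le> spread (w k)"
    by (intro spread_leI) (simp add: spread_def, smt (verit))
  moreover have "spread (w (Suc k)) \<le> spread (\<lambda>i. \<Sum>j\<in>UNIV. W k $ i $ j * w k j) + 2 * p k"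
    by (rule spread_perturb[OF p])
  ultimately show ?thesis by linarith
qed

end

section \<open>Scalar recursions that contract over windows\<close>

text \<open>The bound M satisfies \<open>c \<le> \<theta> * M\<close>, so it is invariant under the
  window recursion; its summands \<open>d 0 + B * c\<close> cover the start, where the one-step
  bound is iterated.\<close>

lemma window_bounded:
  fixes d :: "nat \<Rightarrow> real"
  assumes window: "\<And>s. s \<ge> 1 \<Longrightarrow> d (s + B) \<le> (1 - \<theta>) * d s + c"
    and step: "\<And>s. d (Suc s) \<le> d s + c"
    and "0 < \<theta>" "\<theta> \<le> 1" "0 < B" "0 \<le> c" "0 \<le> d 0"
  shows "d k \<le> d 0 + B * c + c / \<theta>"
proof (induction k rule: less_induct)
  case (less k)
  define M where "M = d 0 + B * c + c / \<theta>"
  have M: "c \<le> \<theta> * M" unfolding M_def using assms(3-) by (simp add: field_simps)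
  show ?case
  \<comment> \<open>The index B belongs to the crude case: a window ending there would start at 0,
    whereas \<open>window\<close> asks for \<open>s \<ge> 1\<close>.\<close>
  proof (cases "k \<le> B")
    case True
    have "d k \<le> d 0 + k * c" for k
    proof (induction k)
      case (Suc k)
      then show ?case using step[of k] by (simp add: algebra_simps)
    qed simp
    from this[of k] have "d k \<le> d 0 + B * c" using True \<open>0 \<le> c\<close>
      by (smt (verit) mult_right_mono of_nat_mono)
    then show ?thesis using assms by (smt (verit) divide_nonneg_pos)
  next
    case False
    have "d k \<le> (1 - \<theta>) * d (k - B) + c" using window[of "k - B"] False by simp
    also have "\<dots> \<le> (1 - \<theta>) * M + c"
      unfolding M_def using less[of "k - B"] False assms by (intro add_mono mult_left_mono) auto
    also have "\<dots> \<le> M" using M by (simp add: algebra_simps)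
    finally show ?thesis by (simp add: M_def)
  qed
qed

lemma sum_shift_le:
  fixes g :: "nat \<Rightarrow> real"
  assumes "\<And>k. 0 \<le> g k"
  shows "(\<Sum>k<K. g (k + m)) \<le> (\<Sum>k<K + m. g k)"
proof -
  have "(\<Sum>k<K. g (k + m)) = (\<Sum>k\<in>{m..<K + m}. g k)"
    using sum.shift_bounds_nat_ivl[of g 0 m K] by (simp add: atLeast0LessThan)
  also have "\<dots> \<le> (\<Sum>k<K + m. g k)" by (intro sum_mono2) (auto intro: assms)
  finally show ?thesis .
qed

text \<open>Multiply the recursion by \<open>\<beta>\<close> at the end of the window and move
  \<open>\<beta>\<close> to earlier indices by antimonotonicity. The weighted sum is then at most
  \<open>1 - \<theta>\<close> times itself plus a start term and sums of squares; absorbing it into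
  the left side causes the division by \<open>\<theta>\<close>.\<close>

lemma window_weighted_sum:
  fixes d :: "nat \<Rightarrow> real"
  assumes window: "\<And>s. s \<ge> 1 \<Longrightarrow> d (s + B) \<le> (1 - \<theta>) * d s + C * (\<Sum>r<B. \<beta> (s + r))"
    and d: "\<And>k. 0 \<le> d k" "\<And>k. d k \<le> D"
    and \<beta>: "\<And>k. 0 \<le> \<beta> k" "antimono \<beta>" and S: "\<And>n. (\<Sum>k<n. (\<beta> k)\<^sup>2) \<le> S"
    and "0 < \<theta>" "\<theta> \<le> 1" "0 \<le> C"
  shows "(\<Sum>k<K. \<beta> k * d k) \<le> (D * (\<Sum>k<B + 1. \<beta> k) + C * B * S) / \<theta>"
proof -
  define T where "T n = (\<Sum>k<n. \<beta> k * d k)" for n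
  have bd: "0 \<le> \<beta> k * d k" for k using \<beta> d by simp
  have mono: "T n \<le> T m" if "n \<le> m" for n m unfolding T_def
    using that bd by (intro sum_mono2) auto
  have each: "\<beta> (k + (B + 1)) * d (k + (B + 1))
      \<le> (1 - \<theta>) * (\<beta> (k + 1) * d (k + 1)) + C * (\<Sum>r<B. (\<beta> (k + (1 + r)))\<^sup>2)" for k
  proof -
    have le: "\<beta> (k + (B + 1)) \<le> \<beta> (k + 1 + r)" if "r \<le> B" for r
      using that \<beta>(2) by (auto simp: antimono_def)
    have "\<beta> (k + (B + 1)) * d (k + (B + 1)) \<le>
        \<beta> (k + (B + 1)) * ((1 - \<theta>) * d (k + 1) + C * (\<Sum>r<B. \<beta> (k + 1 + r)))"
      using window[of "k + 1"] \<beta>(1) by (intro mult_left_mono) (auto simp: add_ac)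
    also have "\<dots> = (1 - \<theta>) * (\<beta> (k + (B + 1)) * d (k + 1))
        + C * (\<Sum>r<B. \<beta> (k + (B + 1)) * \<beta> (k + 1 + r))"
      by (simp add: algebra_simps sum_distrib_left)
    also have "\<dots> \<le> (1 - \<theta>) * (\<beta> (k + 1) * d (k + 1)) + C * (\<Sum>r<B. \<beta> (k + 1 + r) * \<beta> (k + 1 + r))"
      using le[of 0] le d \<beta>(1) assms(7-)
      by (intro add_mono mult_left_mono sum_mono mult_right_mono) auto
    finally show ?thesis by (simp add: power2_eq_square add_ac)
  qed
  have tail: "(\<Sum>k<K. (\<beta> (k + m))\<^sup>2) \<le> S" for m
    using sum_shift_le[of "\<lambda>k. (\<beta> k)\<^sup>2" m K] S[of "K + m"] by simp
  \<comment> \<open>The recursion reaches only the indices from \<open>B + 1\<close> on; the earlier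
    terms are estimated by \<open>D\<close>. On the right the sum is shifted by one and fits into
    \<open>T (K + 1)\<close>, which is why the inequality is closed at \<open>K + 1\<close> and not
    at \<open>K\<close>.\<close>
  have "T (K + 1) \<le> T (K + (B + 1))" by (rule mono) simp
  also have "\<dots> = T (B + 1) + (\<Sum>k<K. \<beta> (k + (B + 1)) * d (k + (B + 1)))"
    unfolding T_def
    by (induction K) (simp_all add: add_ac)
  also have "\<dots> \<le> T (B + 1) + (\<Sum>k<K. (1 - \<theta>) * (\<beta> (k + 1) * d (k + 1))
      + C * (\<Sum>r<B. (\<beta> (k + (1 + r)))\<^sup>2))"
    by (intro add_left_mono sum_mono each)
  also have "\<dots> = T (B + 1) + (1 - \<theta>) * (\<Sum>k<K. \<beta> (k + 1) * d (k + 1))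
      + C * (\<Sum>r<B. \<Sum>k<K. (\<beta> (k + (1 + r)))\<^sup>2)"
    by (subst sum.swap) (simp add: sum.distrib sum_distrib_left)
  also have "\<dots> \<le> D * (\<Sum>k<B + 1. \<beta> k) + (1 - \<theta>) * T (K + 1) + C * (\<Sum>r<B. S)"
  proof (intro add_mono mult_left_mono sum_mono tail)
    show "T (B + 1) \<le> D * (\<Sum>k<B + 1. \<beta> k)"
      unfolding T_def sum_distrib_left using d \<beta>(1)
      by (intro sum_mono) (subst mult.commute, rule mult_right_mono)
    show "(\<Sum>k<K. \<beta> (k + 1) * d (k + 1)) \<le> T (K + 1)"
      unfolding T_def by (rule sum_shift_le) (rule bd)
  qed (use assms in auto)
  finally have "\<theta> * T (K + 1) \<le> D * (\<Sum>k<B + 1. \<beta> k) + C * B * S" by (simp add: algebra_simps)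
  then have "T (K + 1) \<le> (D * (\<Sum>k<B + 1. \<beta> k) + C * B * S) / \<theta>"
    using \<open>0 < \<theta>\<close> by (simp add: field_simps)
  then show ?thesis using mono[of K "K + 1"] unfolding T_def by simp
qed

section \<open>Step-size sums, projections and orthogonal increments\<close>

text \<open>Instead of an integral comparison, the induction step is the weighted inequality of
  arithmetic and geometric means for K and K + 1, multiplied by
  \<open>(real K + 1) powr (- s)\<close>.\<close>

lemma sum_powr_neg_le:
  assumes "0 < s" "s < 1"
  shows "(\<Sum>p<K. (real p + 1) powr (- s)) \<le> real K powr (1 - s) / (1 - s)"
proof (induction K)
  case 0
  then show ?case by simp
next
  case (Suc K)
  have "real K powr (1 - s) * (real K + 1) powr s \<le> (1 - s) * K + s * (real K + 1)"
    using assms by (cases "K = 0") (auto intro!: Youngs_inequality_0)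
  also have "\<dots> = real K + 1 - (1 - s)" by (simp add: algebra_simps)
  finally have "real K powr (1 - s) * ((real K + 1) powr s * (real K + 1) powr (- s))
      \<le> (real K + 1 - (1 - s)) * (real K + 1) powr (- s)"
    unfolding mult.assoc[symmetric] by (rule mult_right_mono) simp
  also have "(real K + 1 - (1 - s)) * (real K + 1) powr (- s)
      = (real K + 1) powr (1 - s) - (1 - s) * (real K + 1) powr (- s)"
    by (simp add: left_diff_distrib powr_mult_base) (simp add: powr_diff powr_minus_divide add_divide_distrib diff_divide_distrib)
  also have "(real K + 1) powr s * (real K + 1) powr (- s) = 1"
    by (simp add: powr_add[symmetric])
  finally have "(real K powr (1 - s) + (1 - s) * (real K + 1) powr (- s)) / (1 - s)
      \<le> (real K + 1) powr (1 - s) / (1 - s)"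
    using assms by (intro divide_right_mono) auto
  then have "real K powr (1 - s) / (1 - s) + (real K + 1) powr (- s) \<le> (real K + 1) powr (1 - s) / (1 - s)"
    using assms by (simp add: add_divide_distrib)
  then show ?case using Suc.IH by (simp add: add.commute)
qed

lemma sum_powr_neg_bounded:
  assumes "s > 1"
  obtains S where "\<And>n. (\<Sum>k<n. (real k + 1) powr (- s)) \<le> S"
proof -
  have "summable (\<lambda>k. (real k + 1) powr (- s))"
    using assms summable_real_powr_iff[of "- s"] summable_Suc_iff[of "\<lambda>n. real n powr (- s)"]
    by (simp add: add.commute)
  then have "(\<Sum>k<n. (real k + 1) powr (- s)) \<le> (\<Sum>k. (real k + 1) powr (- s))" for n
    by (intro sum_le_suminf) auto
  then show thesis by (rule that)
qed

text \<open>\<open>l\<close> is at most 1 and at most \<open>t\<close>, so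
  \<open>l * (k + 1) \<le> k + t\<close>; this puts all offsets on one common rate.\<close>

lemma shifted_powr_le:
  assumes "0 < l" "l \<le> 1" "l \<le> t" "0 \<le> s"
  shows "(real k + t) powr (- s) \<le> l powr (- s) * (real k + 1) powr (- s)"
proof -
  have "l * (real k + 1) \<le> real k + t"
    using assms mult_right_mono[of l 1 "real k"] by (simp add: algebra_simps)
  then have "(real k + t) powr (- s) \<le> (l * (real k + 1)) powr (- s)"
    using assms by (intro powr_mono2') auto
  then show ?thesis using assms by (simp add: powr_mult)
qed

text \<open>Shifting the smallest offset by an integer above all others makes the sum telescope.\<close>

lemma sum_offset_diff_le:
  fixes l t a :: real and m :: nat
  assumes "0 < l" "l \<le> t" "t \<le> l + m" "0 \<le> a"
  shows "(\<Sum>k<n. (real k + l) powr (- a) - (real k + t) powr (- a)) \<le> m * l powr (- a)"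
proof -
  define g where "g k = (real k + l) powr (- a)" for k
  have "(\<Sum>k<n. (real k + l) powr (- a) - (real k + t) powr (- a)) \<le> (\<Sum>k<n. g k - g (k + m))"
  proof (rule sum_mono)
    fix k
    have "(real (k + m) + l) powr (- a) \<le> (real k + t) powr (- a)"
      using assms by (intro powr_mono2') auto
    then show "(real k + l) powr (- a) - (real k + t) powr (- a) \<le> g k - g (k + m)"
      by (simp add: g_def)
  qed
  also have "\<dots> = (\<Sum>k<m. g k) - (\<Sum>k<m. g (k + n))"
  proof -
    have "(\<Sum>k<n. g k) + (\<Sum>k<m. g (k + n)) = (\<Sum>k<n + m. g k)"
      by (induction m) (simp_all add: add_ac)
    moreover have "(\<Sum>k<m. g k) + (\<Sum>k<n. g (k + m)) = (\<Sum>k<n + m. g k)"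
      by (induction n) (simp_all add: add_ac)
    ultimately show ?thesis by (simp add: sum_subtractf)
  qed
  also have "\<dots> \<le> (\<Sum>k<m. g 0)"
  proof -
    have "g k \<le> g 0" for k unfolding g_def using assms by (intro powr_mono2') auto
    then have "(\<Sum>k<m. g k) \<le> (\<Sum>k<m. g 0)" by (intro sum_mono) auto
    moreover have "0 \<le> (\<Sum>k<m. g (k + n))" by (intro sum_nonneg) (simp add: g_def)
    ultimately show ?thesis by linarith
  qed
  finally show ?thesis by (simp add: g_def)
qed

text \<open>Each of the K terms is at least \<open>((1 + t) * K) powr (- a)\<close>, since
  \<open>k + t \<le> (1 + t) * K\<close>. The estimate is crude but of the right order.\<close>

lemma sum_powr_neg_ge:
  assumes "0 \<le> a" "0 < t" "0 < K"
  shows "(1 + t) powr (- a) * real K powr (1 - a) \<le> (\<Sum>k<K. (real k + t) powr (- a))"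
proof -
  have "(1 + t) powr (- a) * real K powr (1 - a) = K * ((1 + t) * K) powr (- a)"
    using assms by (simp add: powr_mult powr_diff powr_minus_divide)
  also have "\<dots> = (\<Sum>k<K. ((1 + t) * K) powr (- a))" by simp
  also have "\<dots> \<le> (\<Sum>k<K. (real k + t) powr (- a))"
  proof (intro sum_mono powr_mono2')
    fix k assume "k \<in> {..<K}"
    then have "real k \<le> K" "t * 1 \<le> t * real K" using assms by (auto intro!: mult_left_mono)
    then show "real k + t \<le> (1 + t) * real K" by (simp add: algebra_simps)
  qed (use assms in auto)
  finally show ?thesis .
qed

text \<open>Projection is nonexpansive and fixes y, so each step expands into a square. Keeping the
  final distance on the left makes the induction telescope. The directions \<open>g\<close> are
  arbitrary, hence may contain noise.\<close>

lemma projected_gradient_regret: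
  fixes x g :: "nat \<Rightarrow> 'a::euclidean_space"
  assumes "closed S" "convex S" "y \<in> S"
    and step: "\<And>k. x (Suc k) = closest_point S (x k - \<alpha> k *\<^sub>R g k)"
  shows "2 * (\<Sum>k<K. \<alpha> k * ((x k - y) \<bullet> g k)) + (norm (x K - y))\<^sup>2
    \<le> (norm (x 0 - y))\<^sup>2 + (\<Sum>k<K. (\<alpha> k * norm (g k))\<^sup>2)"
proof (induction K)
  case 0
  then show ?case by simp
next
  case (Suc K)
  have "norm (x (Suc K) - y) \<le> norm ((x K - y) - \<alpha> K *\<^sub>R g K)"
    using closest_point_lipschitz[OF assms(2,1), of "x K - \<alpha> K *\<^sub>R g K" y] assms(3)
    by (auto simp: step closest_point_self dist_norm algebra_simps)
  then have "(norm (x (Suc K) - y))\<^sup>2 \<le> (norm ((x K - y) - \<alpha> K *\<^sub>R g K))\<^sup>2"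
    by (intro power_mono) auto
  also have "\<dots> = (norm (x K - y))\<^sup>2 - 2 * (\<alpha> K * ((x K - y) \<bullet> g K)) + (\<alpha> K * norm (g K))\<^sup>2"
    unfolding power2_norm_eq_inner power_mult_distrib
    by (simp add: inner_diff inner_commute right_diff_distrib power2_eq_square)
  finally show ?case using Suc.IH by simp
qed

lemma closest_point_step_norm:
  fixes x g :: "'a::euclidean_space"
  assumes "closed S" "convex S" "x \<in> S"
  shows "norm (closest_point S (x - g) - x) \<le> norm g"
  using closest_point_lipschitz[OF assms(2,1), of "x - g" x] assms
  by (auto simp: closest_point_self dist_norm)

section \<open>Moments of sums of martingale differences\<close>

text \<open>Pythagoras for martingale differences. Centring is phrased as orthogonality to bounded
  test functions known at time k; the partial sum is one of them because all increments are bounded,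
  so the mixed term vanishes.\<close>

lemma (in prob_space) orthogonal_increments_second_moment:
  fixes D :: "nat \<Rightarrow> 'a \<Rightarrow> real" and b :: "nat \<Rightarrow> real"
  assumes meas: "\<And>k. D k \<in> borel_measurable M"
    and adapted: "\<And>k. D k \<in> borel_measurable (\<F> (Suc k))"
    and mono: "\<And>k. subalgebra (\<F> (Suc k)) (\<F> k)"
    and bound: "\<And>k \<omega>. \<omega> \<in> space M \<Longrightarrow> \<bar>D k \<omega>\<bar> \<le> b k"
    and orth: "\<And>k g c. g \<in> borel_measurable (\<F> k) \<Longrightarrow> (\<And>\<omega>. \<omega> \<in> space M \<Longrightarrow> \<bar>g \<omega>\<bar> \<le> c) \<Longrightarrow>
      expectation (\<lambda>\<omega>. g \<omega> * D k \<omega>) = 0"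
  shows "expectation (\<lambda>\<omega>. (\<Sum>k<K. D k \<omega>)\<^sup>2) \<le> (\<Sum>k<K. (b k)\<^sup>2)"
proof (induction K)
  case 0
  then show ?case by simp
next
  case (Suc K)
  define S where "S \<omega> = (\<Sum>k<K. D k \<omega>)" for \<omega>
  have up: "subalgebra (\<F> (k + m)) (\<F> k)" for k m
  proof (induction m)
    case (Suc m)
    then show ?case using mono[of "k + m"] unfolding subalgebra_def by auto
  qed (simp add: subalgebra_def)
  have SF: "S \<in> borel_measurable (\<F> K)" unfolding S_def
  proof (rule borel_measurable_sum)
    fix k assume "k \<in> {..<K}"
    then have "\<F> K = \<F> (Suc k + (K - Suc k))" by auto
    then show "D k \<in> borel_measurable (\<F> K)"
      using measurable_from_subalg[OF up adapted] by metis
  qed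
  have [measurable]: "S \<in> borel_measurable M" "D K \<in> borel_measurable M"
    unfolding S_def using meas by auto
  have Sb: "\<bar>S \<omega>\<bar> \<le> (\<Sum>k<K. b k)" if "\<omega> \<in> space M" for \<omega>
    unfolding S_def by (rule order.trans[OF sum_abs]) (intro sum_mono bound that)
  have Db: "\<bar>D K \<omega>\<bar> \<le> b K" if "\<omega> \<in> space M" for \<omega> using bound that .
  have S2: "integrable M (\<lambda>\<omega>. (S \<omega>)\<^sup>2)"
    by (rule integrable_const_bound[of _ "(\<Sum>k<K. b k)\<^sup>2"])
      (use Sb in \<open>auto intro: power_mono_even simp: abs_le_square_iff[symmetric]\<close>, fastforce)
  have SD: "integrable M (\<lambda>\<omega>. S \<omega> * D K \<omega>)"
    by (rule integrable_const_bound[of _ "(\<Sum>k<K. b k) * b K"])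
      (use Sb Db in \<open>auto intro!: mult_mono' simp: abs_mult\<close>)
  have D2: "integrable M (\<lambda>\<omega>. (D K \<omega>)\<^sup>2)"
    by (rule integrable_const_bound[of _ "(b K)\<^sup>2"])
      (use Db in \<open>auto intro: simp: abs_le_square_iff[symmetric]\<close>, fastforce)
  have "expectation (\<lambda>\<omega>. (\<Sum>k<Suc K. D k \<omega>)\<^sup>2)
      = expectation (\<lambda>\<omega>. (S \<omega>)\<^sup>2 + 2 * (S \<omega> * D K \<omega>) + (D K \<omega>)\<^sup>2)"
    by (simp add: S_def power2_sum algebra_simps)
  also have "\<dots> = expectation (\<lambda>\<omega>. (S \<omega>)\<^sup>2) + 2 * expectation (\<lambda>\<omega>. S \<omega> * D K \<omega>) + expectation (\<lambda>\<omega>. (D K \<omega>)\<^sup>2)"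
    using S2 SD D2 by simp
  also have "expectation (\<lambda>\<omega>. S \<omega> * D K \<omega>) = 0" by (rule orth[OF SF Sb])
  also have "expectation (\<lambda>\<omega>. (D K \<omega>)\<^sup>2) \<le> (b K)\<^sup>2"
  proof -
    have "expectation (\<lambda>\<omega>. (D K \<omega>)\<^sup>2) \<le> expectation (\<lambda>\<omega>. (b K)\<^sup>2)"
      using Db D2 by (intro integral_mono) (auto simp: abs_le_square_iff[symmetric], fastforce)
    then show ?thesis by (simp add: prob_space)
  qed
  finally show ?case using Suc.IH unfolding S_def by simp
qed

text \<open>\<open>\<bar>s\<bar> \<le> 1 + s\<^sup>2\<close> passes from second to first moments
  without a square root. First moments can be added over several martingales before a single use of
  Markov's inequality.\<close>

lemma (in prob_space) orthogonal_increments_first_moment: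
  fixes D :: "nat \<Rightarrow> 'a \<Rightarrow> real" and b :: "nat \<Rightarrow> real"
  assumes filtration: "\<And>k. subalgebra M (\<F> k)" "\<And>k. subalgebra (\<F> (Suc k)) (\<F> k)"
    and adapted: "\<And>k. D k \<in> borel_measurable (\<F> (Suc k))"
    and bound: "\<And>k \<omega>. \<omega> \<in> space M \<Longrightarrow> \<bar>D k \<omega>\<bar> \<le> b k"
    and orth: "\<And>k g c. g \<in> borel_measurable (\<F> k) \<Longrightarrow> (\<And>\<omega>. \<omega> \<in> space M \<Longrightarrow> \<bar>g \<omega>\<bar> \<le> c) \<Longrightarrow>
      expectation (\<lambda>\<omega>. g \<omega> * D k \<omega>) = 0"
  shows "integrable M (\<lambda>\<omega>. \<bar>\<Sum>k<K. D k \<omega>\<bar>)"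
    and "expectation (\<lambda>\<omega>. \<bar>\<Sum>k<K. D k \<omega>\<bar>) \<le> 1 + (\<Sum>k<K. (b k)\<^sup>2)"
proof -
  have D_M [measurable]: "D k \<in> borel_measurable M" for k
    using measurable_from_subalg[OF filtration(1) adapted] .
  let ?S = "\<lambda>\<omega>. \<Sum>k<K. D k \<omega>"
  have S: "\<bar>?S \<omega>\<bar> \<le> (\<Sum>k<K. b k)" if "\<omega> \<in> space M" for \<omega>
    by (rule order.trans[OF sum_abs]) (intro sum_mono bound that)
  show int: "integrable M (\<lambda>\<omega>. \<bar>?S \<omega>\<bar>)"
    by (rule integrable_const_bound[of _ "\<Sum>k<K. b k"]) (use S in auto)
  have "(?S \<omega>)\<^sup>2 \<le> (\<Sum>k<K. b k)\<^sup>2" if "\<omega> \<in> space M" for \<omega>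
    using power_mono[OF S[OF that] abs_ge_zero, of 2] by simp
  then have int2: "integrable M (\<lambda>\<omega>. (?S \<omega>)\<^sup>2)"
    by (intro integrable_const_bound[of _ "(\<Sum>k<K. b k)\<^sup>2"]) auto
  have "\<bar>s\<bar> \<le> 1 + s\<^sup>2" for s :: real
    using zero_le_power2[of "\<bar>s\<bar> - 1"] by (simp add: power2_diff)
  then have "expectation (\<lambda>\<omega>. \<bar>?S \<omega>\<bar>) \<le> expectation (\<lambda>\<omega>. 1 + (?S \<omega>)\<^sup>2)"
    using int int2 by (intro integral_mono) auto
  also have "\<dots> = 1 + expectation (\<lambda>\<omega>. (?S \<omega>)\<^sup>2)" using int2 by (simp add: prob_space)
  also have "expectation (\<lambda>\<omega>. (?S \<omega>)\<^sup>2) \<le> (\<Sum>k<K. (b k)\<^sup>2)"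
    by (rule orthogonal_increments_second_moment[where \<F> = \<F> and D = D and b = b,
          OF D_M adapted filtration(2) bound orth])
  finally show "expectation (\<lambda>\<omega>. \<bar>?S \<omega>\<bar>) \<le> 1 + (\<Sum>k<K. (b k)\<^sup>2)" by simp
qed

section \<open>Block coordinates, gradients and the filtration\<close>

lemma block_part_id: "u \<in> block own i \<Longrightarrow> block_part own i u = u"
  by (auto simp: block_part_def block_def vec_eq_iff)

lemma block_part_stack: "u i \<in> block own i \<Longrightarrow> block_part own i (stack own u) = u i"
  by (auto simp: block_part_def block_def stack_def vec_eq_iff)

lemma bounded_linear_block_part: "bounded_linear (block_part own i)"
  unfolding linear_conv_bounded_linear[symmetric]
  by (rule linearI) (auto simp: block_part_def vec_eq_iff)

text \<open>Every coordinate has exactly one owner. This turns the sum of the players' inner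
  products into one inner product with the stacked pseudo-gradient.\<close>

lemma sum_inner_block_part:
  fixes own :: "'c::finite \<Rightarrow> 'n::finite"
  shows "(\<Sum>i\<in>UNIV. block_part own i u \<bullet> w i) = u \<bullet> stack own w"
proof -
  have "(\<Sum>i\<in>UNIV. block_part own i u \<bullet> w i)
      = (\<Sum>c\<in>UNIV. \<Sum>i\<in>UNIV. if own c = i then u $ c * w i $ c else 0)"
    unfolding inner_vec_def by (subst sum.swap) (auto simp: block_part_def intro!: sum.cong)
  then show ?thesis by (simp add: inner_vec_def stack_def)
qed

lemma joint_set_stackI:
  assumes "\<And>i. u i \<in> X i" "\<And>i. X i \<subseteq> block own i"
  shows "stack own u \<in> joint_set own X"
  using assms block_part_stack[of u _ own] by (auto simp: joint_set_def subset_iff)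

text \<open>Used for the axes of foreign coordinates, along which a function composed with
  \<open>block_part\<close> does not change.\<close>

lemma has_derivative_constant_direction:
  assumes D: "(f has_derivative D) (at u)" and const: "\<And>t::real. f (u + t *\<^sub>R e) = f u"
  shows "D e = 0"
proof -
  have "((\<lambda>t. u + t *\<^sub>R e) has_derivative (\<lambda>t. t *\<^sub>R e)) (at (0::real))"
    by (auto intro!: derivative_eq_intros)
  then have "((\<lambda>t. f (u + t *\<^sub>R e)) has_derivative (\<lambda>t. D (t *\<^sub>R e))) (at (0::real))"
    by (rule has_derivative_compose) (simp add: D)
  then have "((\<lambda>t. f u) has_derivative (\<lambda>t. D (t *\<^sub>R e))) (at (0::real))"
    by (simp only: const)
  then have "(\<lambda>t. D (t *\<^sub>R e)) = (\<lambda>t. 0)"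
    by (rule has_derivative_unique) simp
  from fun_cong[OF this, of 1] show ?thesis by simp
qed

lemma block_part_add_axis:
  "own c \<noteq> i \<Longrightarrow> block_part own i (u + t *\<^sub>R axis c 1) = block_part own i u"
  by (auto simp: block_part_def vec_eq_iff axis_def)

lemma C1_on_imp_continuous_on:
  assumes "C1_on U g"
  shows "continuous_on U g"
  using assms unfolding C1_on_def
  by (blast intro: continuous_at_imp_continuous_on has_derivative_continuous)

text \<open>Continuity will make the iterates measurable; membership in the block is what allows
  \<open>block_part\<close> to undo the stacking in \<open>phi\<close>. Both are read off a formula
  in terms of the joint derivative \<open>G\<close>, which is continuous on
  \<open>U\<close>.\<close>

lemma total_grad_regular:
  fixes own :: "'c::finite \<Rightarrow> 'n"
  assumes h: "C1_on UNIV (\<lambda>y. h (block_part own i y))"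
    and U: "S \<times> UNIV \<subseteq> U"
    and g: "C1_on U (\<lambda>(y, s). g (block_part own i y) s)"
    and S: "S \<subseteq> block own i"
  shows total_grad_continuous: "continuous_on (S \<times> UNIV) (\<lambda>(u, z). total_grad own i h g u z)"
    and total_grad_in_block: "u \<in> S \<Longrightarrow> total_grad own i h g u z \<in> block own i"
proof -
  obtain H where H: "\<And>x. ((\<lambda>y. h (block_part own i y)) has_derivative blinfun_apply (H x)) (at x)"
    and Hc: "continuous_on UNIV H" using h unfolding C1_on_def by auto
  obtain G where G: "\<And>p. p \<in> U \<Longrightarrow>
      ((\<lambda>(y, s). g (block_part own i y) s) has_derivative blinfun_apply (G p)) (at p)"
    and Gc: "continuous_on U G" using g unfolding C1_on_def by blast
  have G1: "((\<lambda>y. g (block_part own i y) z) has_derivative (\<lambda>d. G (u, z) (d, 0))) (at u)"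
    if "u \<in> S" for u z
  proof -
    have "((\<lambda>y. (y, z)) has_derivative (\<lambda>d. (d, 0))) (at u)" by (auto intro!: derivative_eq_intros)
    from has_derivative_compose[OF this G] show ?thesis using that U by auto
  qed
  have G2: "((\<lambda>s. g u s) has_derivative (\<lambda>d. G (u, z) (0, d))) (at z)" if "u \<in> S" for u z
  proof -
    have "((\<lambda>s. (u, s)) has_derivative (\<lambda>d. (0, d))) (at z)" by (auto intro!: derivative_eq_intros)
    from has_derivative_compose[OF this G] show ?thesis using that U S 
      by (auto simp: block_part_id subset_iff)
  qed
  have H0: "H u (axis c 1) = 0" if "own c \<noteq> i" for u c
    by (rule has_derivative_constant_direction[OF H]) (simp add: block_part_add_axis[of own c i] that)
  have G0: "G (u, z) (axis c 1, 0) = 0" if "own c \<noteq> i" "u \<in> S" for u c z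
    by (rule has_derivative_constant_direction[OF G1[OF that(2)]]) (simp add: block_part_add_axis[of own c i] that)
  \<comment> \<open>The second summand is row c of the transposed Jacobian applied to the gradient
    in the aggregate.\<close>
  have eq: "total_grad own i h g u z = (\<chi> c. G (u, z) (axis c 1, 0)
      + (\<Sum>d\<in>UNIV. H u (axis c 1) $ d * G (u, z) (0, axis d 1)))" if "u \<in> S" for u z
    unfolding total_grad_def grad_def jacobian_def matrix_def transpose_def
      frechet_derivative_at[OF G1[OF that], symmetric] frechet_derivative_at[OF G2[OF that], symmetric]
      frechet_derivative_at[OF H, symmetric]
    by (simp add: vec_eq_iff matrix_vector_mult_def)
  have "continuous_on (S \<times> UNIV) (\<lambda>p. \<chi> c. G p (axis c 1, 0)
      + (\<Sum>d\<in>UNIV. H (fst p) (axis c 1) $ d * G p (0, axis d 1)))"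
    using continuous_on_subset[OF Gc U]
    by (intro continuous_intros continuous_on_compose2[OF Hc] blinfun.continuous_on) auto
  then show "continuous_on (S \<times> UNIV) (\<lambda>(u, z). total_grad own i h g u z)"
    by (rule continuous_on_cong[THEN iffD1, rotated 2]) (auto simp: eq)
  show "total_grad own i h g u z \<in> block own i" if "u \<in> S"
    unfolding eq[OF that] by (simp add: block_def H0 G0 that)
qed

section \<open>The filtration generated by the initial point and the noise\<close>

lemma
  assumes x0: "x0 \<in> borel_measurable M" and zeta: "\<And>i l. zeta i l \<in> borel_measurable M"
  shows subalgebra_past_algebra: "subalgebra M (past_algebra M x0 zeta k)"
    and past_algebra_mono: "subalgebra (past_algebra M x0 zeta (Suc k)) (past_algebra M x0 zeta k)"
    and initial_measurable_past: "x0 \<in> borel_measurable (past_algebra M x0 zeta k)"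
    and noise_measurable_past: "l < k \<Longrightarrow> zeta i l \<in> borel_measurable (past_algebra M x0 zeta k)"
proof -
  define A where "A k = {x0 -` A \<inter> space M | A. A \<in> sets borel}
      \<union> {zeta i l -` A \<inter> space M | i l A. l < k \<and> A \<in> sets borel}" for k
  have A: "A k \<subseteq> sets M" "A k \<subseteq> Pow (space M)" for k
    using x0 zeta by (auto simp: A_def intro: measurable_sets)
  have past: "past_algebra M x0 zeta k = sigma (space M) (A k)" for k
    by (simp add: past_algebra_def A_def)
  have sets: "sets (past_algebra M x0 zeta k) = sigma_sets (space M) (A k)" for k
    using A by (simp add: past)
  have space: "space (past_algebra M x0 zeta k) = space M" for k by (simp add: past A)
  show "subalgebra M (past_algebra M x0 zeta k)"
    unfolding subalgebra_def sets space using A(1) by (simp add: sets.sigma_sets_subset)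
  have "A k \<subseteq> A (Suc k)" unfolding A_def by (intro Un_mono order_refl Collect_mono) (metis less_SucI)
  then show "subalgebra (past_algebra M x0 zeta (Suc k)) (past_algebra M x0 zeta k)"
    unfolding subalgebra_def sets space by (simp add: sigma_sets_mono')
  show "x0 \<in> borel_measurable (past_algebra M x0 zeta k)"
    by (rule measurableI) (auto simp: sets space A_def intro!: sigma_sets.Basic)
  show "zeta i l \<in> borel_measurable (past_algebra M x0 zeta k)" if "l < k"
    by (rule measurableI) (use that in \<open>auto simp: sets space A_def intro!: sigma_sets.Basic\<close>)
qed

text \<open>A factor known at the earlier time can be pulled into the conditional expectation. This
  turns the centring of the noise into the test-function form used for orthogonal
  increments.\<close>

lemma (in prob_space) expectation_mult_centred_eq_0:
  assumes sub: "subalgebra M F" and z: "z \<in> borel_measurable M" and "g \<in> borel_measurable F"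
    and bounds: "\<And>\<omega>. \<omega> \<in> space M \<Longrightarrow> \<bar>g \<omega>\<bar> \<le> c" "\<And>\<omega>. \<omega> \<in> space M \<Longrightarrow> \<bar>z \<omega>\<bar> \<le> (d::real)"
    and zero: "AE \<omega> in M. real_cond_exp M F z \<omega> = 0"
  shows "expectation (\<lambda>\<omega>. g \<omega> * z \<omega>) = 0"
proof -
  interpret finite_measure_subalgebra M F by unfold_locales (rule sub)
  have [measurable]: "g \<in> borel_measurable M" "z \<in> borel_measurable M"
    using measurable_from_subalg[OF sub assms(3)] z by auto
  have "integrable M (\<lambda>\<omega>. g \<omega> * z \<omega>)"
    by (rule integrable_const_bound[of _ "c * d"])
      (use bounds in \<open>auto intro!: mult_mono' simp: abs_mult\<close>)
  from real_cond_exp_intg(2)[OF this assms(3) z]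
  have "expectation (\<lambda>\<omega>. g \<omega> * z \<omega>) = (\<integral>\<omega>. g \<omega> * real_cond_exp M F z \<omega> \<partial>M)" by simp
  also have "\<dots> = (\<integral>\<omega>. 0 \<partial>M)"
    using zero by (intro integral_cong_AE) auto
  finally show ?thesis by simp
qed

section \<open>Aggregative games\<close>

text \<open>Neither a probability space nor cost functions occur here: \<open>F\<close> is abstract
  and carries only regularity assumptions, so the estimates can be made path by path.\<close>

locale aggregative_game = averaging_network E W vsig P
  for E :: "nat \<Rightarrow> ('n::finite \<times> 'n) set" and W :: "nat \<Rightarrow> real^'n^'n" and vsig P +
  fixes own :: "'c::finite \<Rightarrow> 'n" and X :: "'n \<Rightarrow> (real^'c) set"
    and h :: "'n \<Rightarrow> real^'c \<Rightarrow> real^'c" and F :: "'n \<Rightarrow> real^'c \<Rightarrow> real^'c \<Rightarrow> real^'c"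
    and phi :: "real^'c \<Rightarrow> real^'c" and upsilon :: "'n \<Rightarrow> real"
    and a b :: real and lam del :: "'n \<Rightarrow> real" and alpha eta :: "'n \<Rightarrow> nat \<Rightarrow> real"
  assumes col_sum: "\<And>k j. (\<Sum>i\<in>UNIV. W k $ i $ j) = 1"
    and W_edge: "\<And>k i j. (j, i) \<notin> E k \<Longrightarrow> W k $ i $ j = 0"
    and P_pos: "0 < P"
    and phi_def: "\<And>y. phi y = stack own (\<lambda>i. F i (block_part own i y) (aggregate own h y))"
    and X_nonempty: "\<And>i. X i \<noteq> {}"
    and X_block: "\<And>i. X i \<subseteq> block own i"
    and X_compact: "\<And>i. compact (X i)"
    and X_convex: "\<And>i. convex (X i)"
    and phi_lipschitz: "\<exists>L. L-lipschitz_on (joint_set own X) phi"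
    and phi_monotone: "\<And>y y'. y \<in> joint_set own X \<Longrightarrow> y' \<in> joint_set own X \<Longrightarrow>
          (phi y - phi y') \<bullet> (y - y') \<ge> 0"
    and h_lipschitz: "\<And>i. \<exists>Lh. Lh-lipschitz_on (X i) (h i)"
    and F_lipschitz: "\<And>i cz. cz > 0 \<Longrightarrow> \<exists>Lf. \<forall>u\<in>X i. \<forall>z1 z2. norm z1 \<le> cz \<longrightarrow> norm z2 \<le> cz \<longrightarrow>
          norm (F i u z1 - F i u z2) \<le> Lf * norm (z1 - z2)"
    and F_block: "\<And>i u z. u \<in> X i \<Longrightarrow> F i u z \<in> block own i"
    and lam_pos: "\<And>i. lam i > 0" and del_pos: "\<And>i. del i > 0"
    and ab: "1/2 < a" "0 < b" "a + b < 1"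
    and alpha_def: "\<And>i k. alpha i k = (real k + lam i) powr (- a)"
    and eta_def: "\<And>i k. eta i k = (real k + del i) powr (- b)"
begin

text \<open>One sample path. The sampled gradient appears as \<open>F\<close> plus
  \<open>zeta\<close>, so bounds proved for every \<open>run\<close> have constants that do not
  depend on the path.\<close>

definition run where
  "run x v vhat zeta \<longleftrightarrow>
    (\<forall>i. x i 0 \<in> X i \<and> v i 0 = h i (x i 0)) \<and>
    (\<forall>i k. vhat i k = (\<Sum>j\<in>{j. (j, i) \<in> E k}. W k $ i $ j *\<^sub>R v j k)) \<and>
    (\<forall>i k. x i (Suc k) = closest_point (X i) (x i k - alpha i k *\<^sub>R
        (F i (x i k) (real CARD('n) *\<^sub>R vhat i k) + zeta i k + eta i k *\<^sub>R x i k))) \<and>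
    (\<forall>i k. v i (Suc k) = vhat i k + h i (x i (Suc k)) - h i (x i k)) \<and>
    (\<forall>i k. norm (zeta i k) \<le> upsilon i)"

definition disagreement :: "('n \<Rightarrow> nat \<Rightarrow> real^'c) \<Rightarrow> nat \<Rightarrow> real" where
  "disagreement v k = (\<Sum>c\<in>UNIV. spread (\<lambda>i. v i k $ c))"

lemma disagreement_nonneg: "0 \<le> disagreement v k"
  unfolding disagreement_def by (intro sum_nonneg spread_nonneg)

lemma X_closed: "closed (X i)"
  using X_compact by (rule compact_imp_closed)

lemma strategies_bounded:
  obtains R where "0 < R" "\<And>i u. u \<in> X i \<Longrightarrow> norm u \<le> R"
proof -
  have "bounded (\<Union>i. X i)" by (intro bounded_UN) (auto intro: compact_imp_bounded X_compact)
  then show thesis using that unfolding bounded_pos by blast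
qed

lemma h_bounded:
  obtains H where "0 < H" "\<And>i u. u \<in> X i \<Longrightarrow> norm (h i u) \<le> H"
proof -
  have "bounded (h i ` X i)" for i
    using h_lipschitz[of i] X_compact[of i]
    by (blast intro: compact_imp_bounded compact_continuous_image lipschitz_on_continuous_on)
  then have "bounded (\<Union>i. h i ` X i)" by (intro bounded_UN) auto
  then show thesis using that unfolding bounded_pos by blast
qed

lemma h_lipschitz_uniform:
  obtains L where "0 \<le> L" "\<And>i u w. u \<in> X i \<Longrightarrow> w \<in> X i \<Longrightarrow> norm (h i u - h i w) \<le> L * norm (u - w)"
proof -
  obtain Lh where Lh: "\<And>i. (Lh i)-lipschitz_on (X i) (h i)" using h_lipschitz by metis
  have le: "Lh i \<le> (\<Sum>i\<in>UNIV. Lh i)" for i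
    using Lh by (intro member_le_sum) (auto dest: lipschitz_on_nonneg)
  show thesis
  proof (intro that[of "\<Sum>i\<in>UNIV. Lh i"] sum_nonneg)
    fix i u w assume "u \<in> X i" "w \<in> X i"
    then have "norm (h i u - h i w) \<le> Lh i * norm (u - w)"
      using lipschitz_onD[OF Lh] by (simp add: dist_norm)
    also have "\<dots> \<le> (\<Sum>i\<in>UNIV. Lh i) * norm (u - w)"
      using le by (intro mult_right_mono) auto
    finally show "norm (h i u - h i w) \<le> (\<Sum>i\<in>UNIV. Lh i) * norm (u - w)" .
  qed (use Lh in \<open>auto dest: lipschitz_on_nonneg\<close>)
qed

lemma F_lipschitz_uniform:
  assumes "cz > 0"
  obtains L where "0 \<le> L" "\<And>i u z1 z2. u \<in> X i \<Longrightarrow> norm z1 \<le> cz \<Longrightarrow> norm z2 \<le> cz \<Longrightarrow>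
    norm (F i u z1 - F i u z2) \<le> L * norm (z1 - z2)"
proof -
  obtain Lf where Lf: "\<And>i u z1 z2. u \<in> X i \<Longrightarrow> norm z1 \<le> cz \<Longrightarrow> norm z2 \<le> cz \<Longrightarrow>
    norm (F i u z1 - F i u z2) \<le> Lf i * norm (z1 - z2)"
    using F_lipschitz[OF assms] by metis
  \<comment> \<open>Absolute values make the sum dominate each \<open>Lf i\<close> without a
    discussion of signs.\<close>
  have le: "Lf i \<le> (\<Sum>i\<in>UNIV. \<bar>Lf i\<bar>)" for i
    using member_le_sum[of i UNIV "\<lambda>i. \<bar>Lf i\<bar>"] by auto
  show thesis
    by (intro that[of "\<Sum>i\<in>UNIV. \<bar>Lf i\<bar>"] sum_nonneg)
      (use le in \<open>auto intro!: order.trans[OF Lf] mult_right_mono\<close>)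
qed

lemma joint_set_compact: "compact (joint_set own X)"
proof -
  obtain R where R: "0 < R" "\<And>i u. u \<in> X i \<Longrightarrow> norm u \<le> R" using strategies_bounded by blast
  have "norm y \<le> CARD('n) * R" if "y \<in> joint_set own X" for y
  proof -
    have "y = (\<Sum>i\<in>UNIV. block_part own i y)" by (auto simp: vec_eq_iff block_part_def)
    then have "norm y \<le> (\<Sum>i\<in>UNIV. norm (block_part own i y))" by (metis norm_sum)
    also have "\<dots> \<le> (\<Sum>i\<in>(UNIV::'n set). R)"
      using that by (intro sum_mono R) (auto simp: joint_set_def)
    finally show ?thesis by simp
  qed
  then have "bounded (joint_set own X)" by (auto simp: bounded_iff)
  moreover have "closed (joint_set own X)"
  proof -
    have "joint_set own X = (\<Inter>i. block_part own i -` X i)" by (auto simp: joint_set_def)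
    moreover have "closed (block_part own i -` X i)" for i
      by (intro continuous_closed_vimage X_closed)
        (simp add: bounded_linear_block_part linear_continuous_at)
    ultimately show ?thesis by auto
  qed
  ultimately show ?thesis by (simp add: compact_eq_bounded_closed)
qed

lemma phi_bounded:
  obtains B where "0 < B" "\<And>y. y \<in> joint_set own X \<Longrightarrow> norm (phi y) \<le> B"
proof -
  have "bounded (phi ` joint_set own X)"
    using phi_lipschitz joint_set_compact
    by (blast intro: compact_imp_bounded compact_continuous_image lipschitz_on_continuous_on)
  then show thesis using that unfolding bounded_pos by blast
qed

lemma phi_block:
  assumes "y \<in> joint_set own X"
  shows "block_part own i (phi y) = F i (block_part own i y) (aggregate own h y)"
  unfolding phi_def using assms by (intro block_part_stack F_block) (simp add: joint_set_def)

lemma norm_block_part_le: "norm (block_part own i y) \<le> norm y"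
  unfolding norm_vec_def by (intro L2_set_mono) (auto simp: block_part_def)

section \<open>Tracking of the aggregate along one run\<close>

context
  fixes x v vhat zeta
  assumes run: "run x v vhat zeta"
begin

lemma vhat_eq: "vhat i k = (\<Sum>j\<in>UNIV. W k $ i $ j *\<^sub>R v j k)"
proof -
  have "vhat i k = (\<Sum>j\<in>{j. (j, i) \<in> E k}. W k $ i $ j *\<^sub>R v j k)"
    using run by (simp add: run_def)
  also have "\<dots> = (\<Sum>j\<in>UNIV. W k $ i $ j *\<^sub>R v j k)"
    by (rule sum.mono_neutral_left) (auto simp: W_edge)
  finally show ?thesis .
qed

lemma v_Suc: "v i (Suc k) = vhat i k + h i (x i (Suc k)) - h i (x i k)"
  using run by (simp add: run_def)

lemma run_in_X: "x i k \<in> X i"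
  by (induction k) (use run in \<open>auto simp: run_def intro!: closest_point_in_set X_closed X_nonempty\<close>)

lemma run_joint: "stack own (\<lambda>i. x i k) \<in> joint_set own X"
  by (rule joint_set_stackI) (auto simp: run_in_X X_block)

lemma block_part_run: "block_part own i (stack own (\<lambda>i. x i k)) = x i k"
  using run_in_X X_block by (intro block_part_stack) auto

text \<open>The tracking invariant: mixing conserves the total by the column sums, and the
  corrections exchange each old value of \<open>h i\<close> for the new one.\<close>

lemma sum_v: "(\<Sum>i\<in>UNIV. v i k) = aggregate own h (stack own (\<lambda>i. x i k))"
proof (induction k)
  case 0
  then show ?case using run by (simp add: run_def aggregate_def block_part_run)
next
  case (Suc k)
  have "(\<Sum>i\<in>UNIV. vhat i k) = (\<Sum>j\<in>UNIV. \<Sum>i\<in>UNIV. W k $ i $ j *\<^sub>R v j k)"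
    unfolding vhat_eq by (rule sum.swap)
  also have "\<dots> = (\<Sum>j\<in>UNIV. v j k)"
    by (simp add: scaleR_left.sum[symmetric] col_sum)
  finally show ?case using Suc
    by (simp add: v_Suc sum.distrib sum_subtractf aggregate_def block_part_run)
qed

text \<open>By \<open>sum_v\<close> the error is the sum over j of \<open>vhat i k - v j k\<close>.
  In each coordinate \<open>vhat i k\<close> is an average of the \<open>v j k\<close>, hence within
  the spread of every one of them.\<close>

lemma estimate_error:
  "norm (real CARD('n) *\<^sub>R vhat i k - aggregate own h (stack own (\<lambda>i. x i k)))
    \<le> CARD('n) * disagreement v k"
proof -
  have "\<bar>(real CARD('n) *\<^sub>R vhat i k - (\<Sum>j\<in>UNIV. v j k)) $ c\<bar> \<le> CARD('n) * spread (\<lambda>i. v i k $ c)" for c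
  proof -
    have "\<bar>vhat i k $ c - v j k $ c\<bar> \<le> spread (\<lambda>i. v i k $ c)" for j
    proof -
      have "vhat i k $ c = (\<Sum>j\<in>UNIV. W k $ i $ j * v j k $ c)" by (simp add: vhat_eq)
      moreover have "\<dots> \<le> v j k $ c + spread (\<lambda>i. v i k $ c)"
        by (rule average_le) (use diff_le_spread[of "\<lambda>i. v i k $ c"] in \<open>simp add: algebra_simps\<close>)
      moreover have "v j k $ c - spread (\<lambda>i. v i k $ c) \<le> (\<Sum>j\<in>UNIV. W k $ i $ j * v j k $ c)"
        by (rule average_ge) (use diff_le_spread[of "\<lambda>i. v i k $ c" j] in \<open>simp add: algebra_simps\<close>)
      ultimately show ?thesis by linarith
    qed
    then have "(\<Sum>j\<in>UNIV. \<bar>vhat i k $ c - v j k $ c\<bar>) \<le> (\<Sum>j\<in>(UNIV::'n set). spread (\<lambda>i. v i k $ c))"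
      by (intro sum_mono) auto
    then have "\<bar>\<Sum>j\<in>UNIV. vhat i k $ c - v j k $ c\<bar> \<le> CARD('n) * spread (\<lambda>i. v i k $ c)"
      by (intro order.trans[OF sum_abs]) simp
    moreover have "(real CARD('n) *\<^sub>R vhat i k - (\<Sum>j\<in>UNIV. v j k)) $ c = (\<Sum>j\<in>UNIV. vhat i k $ c - v j k $ c)"
      by (simp add: sum_subtractf)
    ultimately show ?thesis by (simp only:)
  qed
  then have "(\<Sum>c\<in>UNIV. \<bar>(real CARD('n) *\<^sub>R vhat i k - (\<Sum>j\<in>UNIV. v j k)) $ c\<bar>)
      \<le> (\<Sum>c\<in>UNIV. CARD('n) * spread (\<lambda>i. v i k $ c))" by (intro sum_mono)
  then show ?thesis using norm_le_l1_cart[of "real CARD('n) *\<^sub>R vhat i k - (\<Sum>j\<in>UNIV. v j k)"]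
    unfolding sum_v disagreement_def by (simp add: sum_distrib_left)
qed

lemma
  fixes p :: "nat \<Rightarrow> real"
  assumes p: "\<And>i k. norm (h i (x i (Suc k)) - h i (x i k)) \<le> p k"
  shows disagreement_window: "1 \<le> s \<Longrightarrow> disagreement v (s + CARD('n) * P)
      \<le> (1 - vsig ^ (CARD('n) * P)) * disagreement v s + 2 * CARD('c) * (\<Sum>r<CARD('n) * P. p (s + r))"
    and disagreement_step: "disagreement v (Suc k) \<le> disagreement v k + 2 * CARD('c) * p k"
proof -
  have pert: "\<bar>v i (Suc k) $ c - (\<Sum>j\<in>UNIV. W k $ i $ j * v j k $ c)\<bar> \<le> p k" for i k c
  proof -
    have "v i (Suc k) $ c - (\<Sum>j\<in>UNIV. W k $ i $ j * v j k $ c) = (h i (x i (Suc k)) - h i (x i k)) $ c"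
      by (simp add: v_Suc vhat_eq)
    then show ?thesis using component_le_norm_cart[of "h i (x i (Suc k)) - h i (x i k)" c] p[of i k]
      by linarith
  qed
  show "disagreement v (s + CARD('n) * P) \<le> (1 - vsig ^ (CARD('n) * P)) * disagreement v s
      + 2 * CARD('c) * (\<Sum>r<CARD('n) * P. p (s + r))" if "1 \<le> s"
  proof -
    have "disagreement v (s + CARD('n) * P) \<le> (\<Sum>c\<in>(UNIV::'c set).
        (1 - vsig ^ (CARD('n) * P)) * spread (\<lambda>i. v i s $ c) + 2 * (\<Sum>r<CARD('n) * P. p (s + r)))"
      unfolding disagreement_def
      by (intro sum_mono spread_window_perturbed[OF that, where w = "\<lambda>k i. v i k $ _"] pert)
    then show ?thesis by (simp add: disagreement_def sum.distrib sum_distrib_left mult_ac)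
  qed
  have "disagreement v (Suc k) \<le> (\<Sum>c\<in>(UNIV::'c set). spread (\<lambda>i. v i k $ c) + 2 * p k)"
    unfolding disagreement_def
    by (intro sum_mono spread_step_perturbed[where w = "\<lambda>k i. v i k $ _"] pert)
  then show "disagreement v (Suc k) \<le> disagreement v k + 2 * CARD('c) * p k"
    by (simp add: disagreement_def sum.distrib mult_ac)
qed

end

section \<open>Bounds uniform over all runs\<close>

text \<open>The a priori bound: values of \<open>h i\<close> on \<open>X i\<close> are at most H, so
  one step perturbs by at most 2 H whatever the search direction is. Nothing about \<open>F\<close>
  enters, which avoids a circular choice of its Lipschitz constant.\<close>

lemma disagreement_bounded:
  obtains D where "0 < D" "\<And>x v vhat zeta k. run x v vhat zeta \<Longrightarrow> disagreement v k \<le> D"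
proof -
  obtain H where H: "0 < H" "\<And>i u. u \<in> X i \<Longrightarrow> norm (h i u) \<le> H" using h_bounded by blast
  define B where "B = CARD('n) * P"
  \<comment> \<open>\<open>window_bounded\<close> takes one constant for a window and for a single
    step; the window sum dominates the single term because \<open>0 < B\<close>.\<close>
  define c where "c = 2 * CARD('c) * (\<Sum>r<B. 2 * H)"
  define D where "D = CARD('c) * (2 * H) + B * c + c / vsig ^ B"
  have B: "0 < B" by (simp add: B_def P_pos)
  have c: "0 < c" unfolding c_def using H B by simp
  have "disagreement v k \<le> D" if run: "run x v vhat zeta" for x v vhat zeta k
  proof -
    have p: "norm (h i (x i (Suc k)) - h i (x i k)) \<le> 2 * H" for i k
      using H(2)[OF run_in_X[OF run, of i k]] H(2)[OF run_in_X[OF run, of i "Suc k"]]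
        norm_triangle_ineq4[of "h i (x i (Suc k))" "h i (x i k)"] by linarith
    have "spread (\<lambda>i. v i 0 $ c) \<le> 2 * H" for c
    proof (rule spread_leI)
      fix i j
      have "\<bar>v i 0 $ c\<bar> \<le> H" for i
        using H(2)[OF run_in_X[OF run, of i 0]] component_le_norm_cart[of "h i (x i 0)" c] run
        by (simp add: run_def)
      from this[of i] this[of j] show "v i 0 $ c - v j 0 $ c \<le> 2 * H" by linarith
    qed
    then have d0: "disagreement v 0 \<le> (\<Sum>c\<in>(UNIV::'c set). 2 * H)"
      unfolding disagreement_def by (intro sum_mono)
    have "disagreement v k \<le> disagreement v 0 + B * c + c / vsig ^ B"
    proof (rule window_bounded)
      show "disagreement v (s + B) \<le> (1 - vsig ^ B) * disagreement v s + c" if "1 \<le> s" for s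
        using disagreement_window[OF run, of "\<lambda>_. 2 * H", OF p that] unfolding c_def B_def .
      have "2 * CARD('c) * (2 * H) \<le> c" unfolding c_def using B H by simp
      then show "disagreement v (Suc s) \<le> disagreement v s + c" for s
        using disagreement_step[OF run, of "\<lambda>_. 2 * H", OF p, of s] by linarith
    qed (use B c rate_bounds disagreement_nonneg in auto)
    then show ?thesis unfolding D_def using d0 by simp
  qed
  moreover have "0 < D" unfolding D_def using H c rate_bounds(1)[of B]
    by (intro add_pos_nonneg) auto
  ultimately show thesis by (rule that[rotated])
qed

text \<open>At the true aggregate, \<open>F i\<close> is a block of \<open>phi\<close>, hence
  bounded. The Lipschitz condition carries the bound over to the estimated aggregate.\<close>

lemma estimate_constants:
  obtains L B where "0 \<le> L" "0 \<le> B"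
    "\<And>x v vhat zeta i k. run x v vhat zeta \<Longrightarrow>
      norm (F i (x i k) (real CARD('n) *\<^sub>R vhat i k)
        - F i (x i k) (aggregate own h (stack own (\<lambda>i. x i k)))) \<le> L * disagreement v k"
    "\<And>x v vhat zeta i k. run x v vhat zeta \<Longrightarrow> norm (F i (x i k) (real CARD('n) *\<^sub>R vhat i k)) \<le> B"
    "\<And>x v vhat zeta i k. run x v vhat zeta \<Longrightarrow>
      norm (F i (x i k) (aggregate own h (stack own (\<lambda>i. x i k)))) \<le> B"
proof -
  obtain D where D: "0 < D" "\<And>x v vhat zeta k. run x v vhat zeta \<Longrightarrow> disagreement v k \<le> D"
    using disagreement_bounded by blast
  obtain H where H: "0 < H" "\<And>i u. u \<in> X i \<Longrightarrow> norm (h i u) \<le> H" using h_bounded by blast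
  obtain B where B: "0 < B" "\<And>y. y \<in> joint_set own X \<Longrightarrow> norm (phi y) \<le> B" using phi_bounded by blast
  \<comment> \<open>A radius containing both arguments of \<open>F\<close>: the aggregate has norm
    at most N H, and the estimate differs from it by at most N D.\<close>
  define cz where "cz = CARD('n) * H + CARD('n) * D"
  have "0 < cz" unfolding cz_def using H D by (intro add_pos_pos) auto
  then obtain L where L: "0 \<le> L" "\<And>i u z1 z2. u \<in> X i \<Longrightarrow> norm z1 \<le> cz \<Longrightarrow> norm z2 \<le> cz \<Longrightarrow>
    norm (F i u z1 - F i u z2) \<le> L * norm (z1 - z2)" using F_lipschitz_uniform by blast
  have err: "norm (F i (x i k) (real CARD('n) *\<^sub>R vhat i k)
        - F i (x i k) (aggregate own h (stack own (\<lambda>i. x i k)))) \<le> L * CARD('n) * disagreement v k"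
    if run: "run x v vhat zeta" for x v vhat zeta i k
  proof -
    let ?z = "real CARD('n) *\<^sub>R vhat i k" and ?s = "aggregate own h (stack own (\<lambda>i. x i k))"
    have e: "norm (?z - ?s) \<le> CARD('n) * disagreement v k" by (rule estimate_error[OF run])
    have "norm ?s \<le> (\<Sum>j\<in>(UNIV::'n set). H)"
      unfolding aggregate_def
      by (rule sum_norm_le) (simp add: block_part_run[OF run] H run_in_X[OF run])
    then have s: "norm ?s \<le> CARD('n) * H" by simp
    have "CARD('n) * disagreement v k \<le> CARD('n) * D"
      by (intro mult_left_mono D(2)[OF run]) simp
    moreover have "0 \<le> CARD('n) * D" using D(1) by simp
    ultimately have "norm ?z \<le> cz" "norm ?s \<le> cz"
      using e s norm_triangle_ineq2[of ?z ?s] unfolding cz_def by linarith+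
    then have "norm (F i (x i k) ?z - F i (x i k) ?s) \<le> L * norm (?z - ?s)"
      by (intro L(2) run_in_X[OF run])
    also have "\<dots> \<le> L * (CARD('n) * disagreement v k)" using e L(1) by (rule mult_left_mono)
    finally show ?thesis by (simp add: mult.assoc)
  qed
  have true: "norm (F i (x i k) (aggregate own h (stack own (\<lambda>i. x i k)))) \<le> B"
    if run: "run x v vhat zeta" for x v vhat zeta i k
    using phi_block[OF run_joint[OF run, of k], of i] B(2)[OF run_joint[OF run, of k]]
      norm_block_part_le[of i "phi (stack own (\<lambda>i. x i k))"]
    by (simp add: block_part_run[OF run])
  have "norm (F i (x i k) (real CARD('n) *\<^sub>R vhat i k)) \<le> B + L * CARD('n) * D"
    if run: "run x v vhat zeta" for x v vhat zeta i k
  proof -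
    have "L * CARD('n) * disagreement v k \<le> L * CARD('n) * D"
      using L(1) D(2)[OF run] by (intro mult_left_mono) auto
    then show ?thesis using err[OF run, of i k] true[OF run, of i k]
      norm_triangle_ineq2[of "F i (x i k) (real CARD('n) *\<^sub>R vhat i k)"
        "F i (x i k) (aggregate own h (stack own (\<lambda>i. x i k)))"] by linarith
  qed
  moreover have "0 \<le> L * CARD('n) * D" using L D by simp
  moreover from this have "norm (F i (x i k) (aggregate own h (stack own (\<lambda>i. x i k)))) \<le> B + L * CARD('n) * D"
    if "run x v vhat zeta" for x v vhat zeta i k
    using true[OF that, of i k] by linarith
  ultimately show thesis using err B(1) L(1)
    by (intro that[of "L * CARD('n)" "B + L * CARD('n) * D"]) auto
qed

lemma alpha_pos: "0 < alpha i k" and eta_pos: "0 < eta i k"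
  using lam_pos[of i] del_pos[of i] by (auto simp: alpha_def eta_def add_nonneg_pos)

lemma step_bounds:
  obtains A B where "0 < A" "\<And>i k. alpha i k \<le> A * (real k + 1) powr (- a)"
    "0 < B" "\<And>i k. eta i k \<le> B * (real k + 1) powr (- b)"
proof -
  have bound: "\<exists>A>0. \<forall>i k. (real k + t i) powr (- s) \<le> A * (real k + 1) powr (- s)"
    if "\<And>i. 0 < t i" "0 \<le> s" for t :: "'n \<Rightarrow> real" and s
  proof -
    define l where "l = min 1 (Min (range t))"
    have l: "0 < l" "l \<le> 1" "\<And>i. l \<le> t i" using that(1) by (auto simp: l_def min_le_iff_disj)
    show ?thesis
      by (rule exI[of _ "l powr (- s)"]) (use l that(2) in \<open>auto intro!: shifted_powr_le\<close>)
  qed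
  have "0 \<le> a" "0 \<le> b" using ab by auto
  then obtain A B where "0 < A" "\<forall>i k. (real k + lam i) powr (- a) \<le> A * (real k + 1) powr (- a)"
    "0 < B" "\<forall>i k. (real k + del i) powr (- b) \<le> B * (real k + 1) powr (- b)"
    using bound[of lam a] bound[of del b] lam_pos del_pos by blast
  then show thesis by (intro that[of A B]) (simp_all add: alpha_def eta_def)
qed

text \<open>All players share the exponent, so the one with the smallest offset has the largest step
  at every time. The maximal step is thus a single power sequence.\<close>

lemma alpha_Max:
  obtains i0 where "\<And>k. (MAX i. alpha i k) = alpha i0 k" "\<And>i. lam i0 \<le> lam i"
proof -
  have "Min (range lam) \<in> range lam" by (intro Min_in) auto
  then obtain i0 where "lam i0 = Min (range lam)" by (metis rangeE)
  then have i0: "lam i0 \<le> lam i" for i by simp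
  have "alpha i k \<le> alpha i0 k" for i k
    unfolding alpha_def using i0[of i] lam_pos[of i0] ab by (intro powr_mono2') auto
  then have "(MAX i. alpha i k) = alpha i0 k" for k by (intro Max_eqI) auto
  then show thesis using i0 by (rule that)
qed

lemma search_direction_bounded:
  obtains G where "0 < G" "\<And>x v vhat zeta i k. run x v vhat zeta \<Longrightarrow>
    norm (F i (x i k) (real CARD('n) *\<^sub>R vhat i k) + zeta i k + eta i k *\<^sub>R x i k) \<le> G"
proof -
  obtain L B where "0 \<le> L" and B: "0 \<le> B" and
    "\<And>x v vhat zeta i k. run x v vhat zeta \<Longrightarrow>
      norm (F i (x i k) (real CARD('n) *\<^sub>R vhat i k)
        - F i (x i k) (aggregate own h (stack own (\<lambda>i. x i k)))) \<le> L * disagreement v k" and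
    FB: "\<And>x v vhat zeta i k. run x v vhat zeta \<Longrightarrow> norm (F i (x i k) (real CARD('n) *\<^sub>R vhat i k)) \<le> B" and
    "\<And>x v vhat zeta i k. run x v vhat zeta \<Longrightarrow>
      norm (F i (x i k) (aggregate own h (stack own (\<lambda>i. x i k)))) \<le> B"
    using estimate_constants by blast
  obtain R where R: "0 < R" "\<And>i u. u \<in> X i \<Longrightarrow> norm u \<le> R" using strategies_bounded by blast
  obtain A Ae where "0 < A" "\<And>i k. alpha i k \<le> A * (real k + 1) powr (- a)"
    and Ae: "0 < Ae" "\<And>i k. eta i k \<le> Ae * (real k + 1) powr (- b)"
    using step_bounds by blast
  define U where "U = (\<Sum>i\<in>UNIV. \<bar>upsilon i\<bar>)"
  have "norm (F i (x i k) (real CARD('n) *\<^sub>R vhat i k) + zeta i k + eta i k *\<^sub>R x i k) \<le> B + U + Ae * R + 1"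
    if run: "run x v vhat zeta" for x v vhat zeta i k
  proof -
    have "(real k + 1) powr (- b) \<le> 1 powr (- b)" using ab by (intro powr_mono2') auto
    then have "Ae * (real k + 1) powr (- b) \<le> Ae * 1" using Ae(1) by (intro mult_left_mono) auto
    then have "eta i k \<le> Ae" using Ae(2)[of i k] by simp
    then have "norm (eta i k *\<^sub>R x i k) \<le> Ae * R"
      using R(2)[OF run_in_X[OF run]] eta_pos[of i k] by (auto intro!: mult_mono)
    moreover have "norm (zeta i k) \<le> U"
    proof -
      have "norm (zeta i k) \<le> \<bar>upsilon i\<bar>" using run unfolding run_def
        by (meson abs_ge_self order.trans)
      also have "\<dots> \<le> U" unfolding U_def by (rule member_le_sum) auto
      finally show ?thesis .
    qed
    ultimately show ?thesis using FB[OF run, of i k]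
      norm_triangle_ineq[of "F i (x i k) (real CARD('n) *\<^sub>R vhat i k) + zeta i k" "eta i k *\<^sub>R x i k"]
      norm_triangle_ineq[of "F i (x i k) (real CARD('n) *\<^sub>R vhat i k)" "zeta i k"] by linarith
  qed
  moreover have "0 < B + U + Ae * R + 1" unfolding U_def using B Ae R
    by (intro add_nonneg_pos add_nonneg_nonneg sum_nonneg) auto
  ultimately show thesis by (rule that[rotated])
qed

lemma step_square_sum_bounded:
  obtains S where "\<And>n. (\<Sum>k<n. ((real k + 1) powr (- a))\<^sup>2) \<le> S"
proof -
  obtain S where S: "\<And>n. (\<Sum>k<n. (real k + 1) powr (- (2 * a))) \<le> S"
    using sum_powr_neg_bounded[of "2 * a"] ab by auto
  have "((real k + 1) powr (- a))\<^sup>2 = (real k + 1) powr (- (2 * a))" for k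
    by (simp add: power2_eq_square powr_add[symmetric])
  then show thesis using S by (intro that) simp
qed

text \<open>The power \<open>(real k + 1) powr (- a)\<close> dominates all steps up to a constant
  and is antimonotone, so it serves as the weight and as the size of the perturbation at once. The
  factor \<open>Q\<close> multiplies the Lipschitz constant of h, the step constant and the
  direction bound.\<close>

lemma weighted_disagreement_bounded:
  obtains C where "\<And>x v vhat zeta K. run x v vhat zeta \<Longrightarrow>
    (\<Sum>k<K. (real k + 1) powr (- a) * disagreement v k) \<le> C"
proof -
  obtain D where "0 < D" and D: "\<And>x v vhat zeta k. run x v vhat zeta \<Longrightarrow> disagreement v k \<le> D"
    using disagreement_bounded by blast
  obtain G where G: "0 < G" "\<And>x v vhat zeta i k. run x v vhat zeta \<Longrightarrow>
    norm (F i (x i k) (real CARD('n) *\<^sub>R vhat i k) + zeta i k + eta i k *\<^sub>R x i k) \<le> G"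
    using search_direction_bounded by blast
  obtain A Ae where A: "0 < A" "\<And>i k. alpha i k \<le> A * (real k + 1) powr (- a)"
    and "0 < Ae" "\<And>i k. eta i k \<le> Ae * (real k + 1) powr (- b)"
    using step_bounds by blast
  obtain L where L: "0 \<le> L"
    "\<And>i u w. u \<in> X i \<Longrightarrow> w \<in> X i \<Longrightarrow> norm (h i u - h i w) \<le> L * norm (u - w)"
    using h_lipschitz_uniform by blast
  obtain S where S: "\<And>n. (\<Sum>k<n. ((real k + 1) powr (- a))\<^sup>2) \<le> S"
    using step_square_sum_bounded by blast
  define Q where "Q = L * (A * G)"
  define N where "N = CARD('n) * P"
  have Q: "0 \<le> Q" unfolding Q_def using L A G by simp
  have "(\<Sum>k<K. (real k + 1) powr (- a) * disagreement v k)
      \<le> (D * (\<Sum>k<N + 1. (real k + 1) powr (- a)) + (2 * CARD('c) * Q) * N * S) / vsig ^ N"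
    if run: "run x v vhat zeta" for x v vhat zeta K
  proof -
    have p: "norm (h i (x i (Suc k)) - h i (x i k)) \<le> Q * (real k + 1) powr (- a)" for i k
    proof -
      let ?g = "F i (x i k) (real CARD('n) *\<^sub>R vhat i k) + zeta i k + eta i k *\<^sub>R x i k"
      have "x i (Suc k) = closest_point (X i) (x i k - alpha i k *\<^sub>R ?g)"
        using run by (simp add: run_def)
      then have "norm (x i (Suc k) - x i k) \<le> norm (alpha i k *\<^sub>R ?g)"
        using closest_point_step_norm[OF X_closed X_convex run_in_X[OF run], of i k "alpha i k *\<^sub>R ?g"]
        by simp
      also have "\<dots> = alpha i k * norm ?g" using alpha_pos[of i k] by simp
      also have "\<dots> \<le> (A * (real k + 1) powr (- a)) * G"
        using A G(2)[OF run] alpha_pos[of i k] by (intro mult_mono) auto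
      finally have "L * norm (x i (Suc k) - x i k) \<le> L * ((A * (real k + 1) powr (- a)) * G)"
        using L(1) by (rule mult_left_mono)
      then show ?thesis using L(2)[OF run_in_X[OF run, of i "Suc k"] run_in_X[OF run, of i k]]
        by (simp add: Q_def mult_ac)
    qed
    show ?thesis
    proof (rule window_weighted_sum[OF _ disagreement_nonneg D[OF run] _ _ S])
      show "disagreement v (s + N) \<le> (1 - vsig ^ N) * disagreement v s
        + 2 * CARD('c) * Q * (\<Sum>r<N. (real (s + r) + 1) powr (- a))" if "1 \<le> s" for s
        using disagreement_window[OF run, of "\<lambda>k. Q * (real k + 1) powr (- a)", OF p that]
        unfolding N_def by (simp add: sum_distrib_left mult_ac)
      show "antimono (\<lambda>k. (real k + 1) powr (- a))"
        using ab by (intro antimonoI powr_mono2') auto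
    qed (use rate_bounds Q in auto)
  qed
  then show thesis by (rule that)
qed

section \<open>Regret and gap along one path\<close>

definition noise ::
  "real \<Rightarrow> ('n \<Rightarrow> nat \<Rightarrow> real^'c) \<Rightarrow> ('n \<Rightarrow> nat \<Rightarrow> real^'c) \<Rightarrow> nat \<Rightarrow> real" where
  "noise R x zeta K = \<bar>\<Sum>k<K. \<Sum>i\<in>UNIV. alpha i k * (x i k \<bullet> zeta i k)\<bar>
    + R * (\<Sum>i\<in>UNIV. \<Sum>c\<in>UNIV. \<bar>\<Sum>k<K. alpha i k * zeta i k $ c\<bar>)"

lemma weighted_regret:
  obtains C1 C2 R where "0 < C1" "0 < C2" "0 < R"
    "\<And>i u. u \<in> X i \<Longrightarrow> norm u \<le> R"
    "\<And>x v vhat zeta K y. run x v vhat zeta \<Longrightarrow> y \<in> joint_set own X \<Longrightarrow>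
      (\<Sum>k<K. (MAX i. alpha i k) * ((stack own (\<lambda>i. x i k) - y) \<bullet> phi y))
        \<le> C1 + noise R x zeta K + C2 * real K powr (1 - a - b)"
proof -
  obtain R where R: "0 < R" "\<And>i u. u \<in> X i \<Longrightarrow> norm u \<le> R" using strategies_bounded by blast
  obtain G where G: "0 < G" "\<And>x v vhat zeta i k. run x v vhat zeta \<Longrightarrow>
    norm (F i (x i k) (real CARD('n) *\<^sub>R vhat i k) + zeta i k + eta i k *\<^sub>R x i k) \<le> G"
    using search_direction_bounded by blast
  obtain A Ae where A: "0 < A" "\<And>i k. alpha i k \<le> A * (real k + 1) powr (- a)"
    and Ae: "0 < Ae" "\<And>i k. eta i k \<le> Ae * (real k + 1) powr (- b)"
    using step_bounds by blast
  obtain S where S: "\<And>n. (\<Sum>k<n. ((real k + 1) powr (- a))\<^sup>2) \<le> S"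
    using step_square_sum_bounded by blast
  obtain Cd where Cd: "\<And>x v vhat zeta K. run x v vhat zeta \<Longrightarrow>
    (\<Sum>k<K. (real k + 1) powr (- a) * disagreement v k) \<le> Cd"
    using weighted_disagreement_bounded by blast
  obtain L B where L: "0 \<le> L" and B: "0 \<le> B" and
    err: "\<And>x v vhat zeta i k. run x v vhat zeta \<Longrightarrow>
      norm (F i (x i k) (real CARD('n) *\<^sub>R vhat i k)
        - F i (x i k) (aggregate own h (stack own (\<lambda>i. x i k)))) \<le> L * disagreement v k" and
    "\<And>x v vhat zeta i k. run x v vhat zeta \<Longrightarrow> norm (F i (x i k) (real CARD('n) *\<^sub>R vhat i k)) \<le> B" and
    FB: "\<And>x v vhat zeta i k. run x v vhat zeta \<Longrightarrow>
      norm (F i (x i k) (aggregate own h (stack own (\<lambda>i. x i k)))) \<le> B"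
    using estimate_constants by blast
  obtain i0 where i0: "\<And>k. (MAX i. alpha i k) = alpha i0 k" "\<And>i. lam i0 \<le> lam i"
    using alpha_Max by blast
  \<comment> \<open>An integer shift that carries the smallest offset past all others, as
    \<open>sum_offset_diff_le\<close> asks.\<close>
  obtain m :: nat where "Max (range lam) \<le> real m" using real_arch_simple by blast
  then have m: "lam i \<le> lam i0 + m" for i
    using Max_ge[of "range lam" "lam i"] lam_pos[of i0] by (simp, smt (verit))
  \<comment> \<open>The summands stem from the initial distance to y, the squared steps, the
    exchange of \<open>alpha i k\<close> for the largest step, and the error of the aggregate
    estimates. Regularization goes into \<open>C2\<close>, since the bound for its sum grows with
    K.\<close>
  define C where "C = (2 * R)\<^sup>2 / 2 + (A * G)\<^sup>2 * S / 2 + 2 * R * B * (m * lam i0 powr (- a)) + 2 * R * L * A * Cd"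
  define C1 where "C1 = \<bar>CARD('n) * C\<bar> + 1"
  define C2 where "C2 = CARD('n) * (2 * R * R * (A * Ae) / (1 - (a + b)))"
  have regret: "(\<Sum>k<K. (MAX i. alpha i k) * ((stack own (\<lambda>i. x i k) - y) \<bullet> phi y))
        \<le> C1 + noise R x zeta K + C2 * real K powr (1 - a - b)"
    if run: "run x v vhat zeta" and y: "y \<in> joint_set own X" for x v vhat zeta K y
  proof -
    define s where "s k = stack own (\<lambda>i. x i k)" for k
    define g where "g i k = F i (x i k) (real CARD('n) *\<^sub>R vhat i k) + zeta i k + eta i k *\<^sub>R x i k" for i k
    define t where "t i k = (x i k - block_part own i y) \<bullet> F i (x i k) (aggregate own h (s k))" for i k
    have yX: "block_part own i y \<in> X i" for i using y by (simp add: joint_set_def)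
    have xX: "x i k \<in> X i" for i k by (rule run_in_X[OF run])
    have diff: "norm (x i k - block_part own i y) \<le> 2 * R" for i k
      using norm_triangle_ineq4[of "x i k" "block_part own i y"] R(2)[OF xX, of i k] R(2)[OF yX, of i]
      by linarith
    have cs: "\<bar>(x i k - block_part own i y) \<bullet> w\<bar> \<le> 2 * R * c" if "norm w \<le> c" for i k w c
      using Cauchy_Schwarz_ineq2[of "x i k - block_part own i y" w]
        mult_mono[OF diff that] R(1) by (smt (verit) norm_ge_zero)
    \<comment> \<open>The weight \<open>alpha i0 k\<close> is common to all players. Monotonicity
      concerns the joint vector, so the terms \<open>t i k\<close> must be added with equal weights
      before it can be used. The exchange of weights can use a bound for \<open>t i k\<close>
      because \<open>alpha i0 k - alpha i k\<close> is nonnegative.\<close>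
    have point: "alpha i0 k * t i k \<le> alpha i k * ((x i k - block_part own i y) \<bullet> g i k)
        + 2 * R * B * (alpha i0 k - alpha i k) + 2 * R * L * A * ((real k + 1) powr (- a) * disagreement v k)
        - alpha i k * (x i k \<bullet> zeta i k) + alpha i k * (block_part own i y \<bullet> zeta i k)
        + 2 * R * R * (A * Ae) * (real k + 1) powr (- (a + b))" for i k
    proof -
      let ?d = "x i k - block_part own i y" and ?s = "aggregate own h (s k)"
      let ?Fh = "F i (x i k) (real CARD('n) *\<^sub>R vhat i k)"
      have dg: "?d \<bullet> g i k = ?d \<bullet> (?Fh - F i (x i k) ?s) + t i k + (x i k \<bullet> zeta i k)
          - (block_part own i y \<bullet> zeta i k) + eta i k * (?d \<bullet> x i k)"
        unfolding g_def t_def by (simp add: inner_add_right inner_diff_right inner_diff_left)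
      have g: "alpha i k * (?d \<bullet> g i k) = alpha i k * (?d \<bullet> (?Fh - F i (x i k) ?s)) + alpha i k * t i k
          + alpha i k * (x i k \<bullet> zeta i k) - alpha i k * (block_part own i y \<bullet> zeta i k)
          + (alpha i k * eta i k) * (?d \<bullet> x i k)"
        unfolding dg by (simp only: distrib_left right_diff_distrib mult.assoc)
      have dis: "0 \<le> disagreement v k" by (rule disagreement_nonneg)
      have "\<bar>?d \<bullet> (?Fh - F i (x i k) ?s)\<bar> \<le> 2 * R * (L * disagreement v k)"
        unfolding s_def by (rule cs[OF err[OF run]])
      then have "alpha i k * \<bar>?d \<bullet> (?Fh - F i (x i k) ?s)\<bar>
          \<le> (A * (real k + 1) powr (- a)) * (2 * R * (L * disagreement v k))"
        using A alpha_pos[of i k] R L dis by (intro mult_mono) auto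
      then have 1: "- (alpha i k * (?d \<bullet> (?Fh - F i (x i k) ?s)))
          \<le> 2 * R * L * A * ((real k + 1) powr (- a) * disagreement v k)"
        using mult_left_mono[of "- (?d \<bullet> (?Fh - F i (x i k) ?s))" "\<bar>?d \<bullet> (?Fh - F i (x i k) ?s)\<bar>" "alpha i k"]
          alpha_pos[of i k] by (simp add: mult_ac) linarith
      have "alpha i k \<le> alpha i0 k"
        unfolding alpha_def using i0(2)[of i] lam_pos[of i0] ab by (intro powr_mono2') auto
      moreover have "\<bar>t i k\<bar> \<le> 2 * R * B" unfolding t_def s_def by (rule cs[OF FB[OF run]])
      ultimately have "(alpha i0 k - alpha i k) * t i k \<le> (alpha i0 k - alpha i k) * (2 * R * B)"
        by (intro mult_left_mono) auto
      then have 2: "alpha i0 k * t i k - alpha i k * t i k \<le> 2 * R * B * (alpha i0 k - alpha i k)"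
        by (simp add: algebra_simps)
      have "\<bar>?d \<bullet> x i k\<bar> \<le> 2 * R * R" by (rule cs[OF R(2)[OF xX]])
      moreover have "alpha i k * eta i k \<le> (A * (real k + 1) powr (- a)) * (Ae * (real k + 1) powr (- b))"
        using A Ae alpha_pos[of i k] eta_pos[of i k] by (intro mult_mono) auto
      moreover have "(A * (real k + 1) powr (- a)) * (Ae * (real k + 1) powr (- b))
          = A * Ae * (real k + 1) powr (- (a + b))"
        by (simp add: powr_add[symmetric])
      ultimately have "(alpha i k * eta i k) * \<bar>?d \<bullet> x i k\<bar> \<le> (A * Ae * (real k + 1) powr (- (a + b))) * (2 * R * R)"
        using alpha_pos[of i k] eta_pos[of i k] A(1) Ae(1)
        by (intro mult_mono[of "alpha i k * eta i k"]) simp_all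
      moreover have "- ((alpha i k * eta i k) * (?d \<bullet> x i k)) \<le> (alpha i k * eta i k) * \<bar>?d \<bullet> x i k\<bar>"
        using alpha_pos[of i k] eta_pos[of i k]
          mult_left_mono[of "- (?d \<bullet> x i k)" "\<bar>?d \<bullet> x i k\<bar>" "alpha i k * eta i k"] by simp
      ultimately have 3: "- ((alpha i k * eta i k) * (?d \<bullet> x i k)) \<le> 2 * R * R * (A * Ae) * (real k + 1) powr (- (a + b))"
        by (simp add: mult_ac)
      show ?thesis using g 1 2 3 by linarith
    qed
    have each: "(\<Sum>k<K. alpha i0 k * t i k) \<le> C
        - (\<Sum>k<K. alpha i k * (x i k \<bullet> zeta i k)) + R * (\<Sum>c\<in>UNIV. \<bar>\<Sum>k<K. alpha i k * zeta i k $ c\<bar>)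
        + (2 * R * R * (A * Ae) / (1 - (a + b))) * real K powr (1 - a - b)" for i
    proof -
      have "2 * (\<Sum>k<K. alpha i k * ((x i k - block_part own i y) \<bullet> g i k)) + (norm (x i K - block_part own i y))\<^sup>2
          \<le> (norm (x i 0 - block_part own i y))\<^sup>2 + (\<Sum>k<K. (alpha i k * norm (g i k))\<^sup>2)"
        by (rule projected_gradient_regret[OF X_closed X_convex yX])
          (use run in \<open>simp add: run_def g_def\<close>)
      moreover have "(norm (x i 0 - block_part own i y))\<^sup>2 \<le> (2 * R)\<^sup>2"
        using diff by (intro power_mono) auto
      moreover have "(\<Sum>k<K. (alpha i k * norm (g i k))\<^sup>2) \<le> (A * G)\<^sup>2 * S"
      proof -
        have "(alpha i k * norm (g i k))\<^sup>2 \<le> ((A * (real k + 1) powr (- a)) * G)\<^sup>2" for k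
          unfolding g_def using A G(2)[OF run] alpha_pos[of i k]
          by (intro power_mono mult_mono) auto
        then have "(\<Sum>k<K. (alpha i k * norm (g i k))\<^sup>2) \<le> (\<Sum>k<K. (A * G)\<^sup>2 * ((real k + 1) powr (- a))\<^sup>2)"
          by (intro sum_mono) (simp add: power_mult_distrib mult_ac)
        also have "\<dots> \<le> (A * G)\<^sup>2 * S"
          unfolding sum_distrib_left[symmetric] by (intro mult_left_mono S) auto
        finally show ?thesis .
      qed
      moreover have "0 \<le> (norm (x i K - block_part own i y))\<^sup>2" by simp
      ultimately have 1: "(\<Sum>k<K. alpha i k * ((x i k - block_part own i y) \<bullet> g i k))
          \<le> (2 * R)\<^sup>2 / 2 + (A * G)\<^sup>2 * S / 2" by linarith
      have 2: "2 * R * B * (\<Sum>k<K. alpha i0 k - alpha i k) \<le> 2 * R * B * (m * lam i0 powr (- a))"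
        unfolding alpha_def using R B ab by (intro mult_left_mono sum_offset_diff_le lam_pos i0 m) auto
      have 3: "2 * R * L * A * (\<Sum>k<K. (real k + 1) powr (- a) * disagreement v k) \<le> 2 * R * L * A * Cd"
        using R L A by (intro mult_left_mono Cd[OF run]) auto
      \<comment> \<open>Absolute values are taken only after the sums are exchanged, so that
        cancellation over time survives in each coordinate.\<close>
      have 4: "(\<Sum>k<K. alpha i k * (block_part own i y \<bullet> zeta i k))
          \<le> R * (\<Sum>c\<in>UNIV. \<bar>\<Sum>k<K. alpha i k * zeta i k $ c\<bar>)"
      proof -
        have "(\<Sum>k<K. alpha i k * (block_part own i y \<bullet> zeta i k))
            = (\<Sum>c\<in>UNIV. block_part own i y $ c * (\<Sum>k<K. alpha i k * zeta i k $ c))"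
          unfolding inner_vec_def sum_distrib_left by (subst sum.swap) (simp add: mult_ac)
        also have "\<dots> \<le> (\<Sum>c\<in>UNIV. R * \<bar>\<Sum>k<K. alpha i k * zeta i k $ c\<bar>)"
        proof (intro sum_mono)
          fix c
          have "\<bar>block_part own i y $ c\<bar> \<le> R"
            using component_le_norm_cart[of "block_part own i y" c] R(2)[OF yX] by (rule order.trans)
          then have "\<bar>block_part own i y $ c * (\<Sum>k<K. alpha i k * zeta i k $ c)\<bar>
              \<le> R * \<bar>\<Sum>k<K. alpha i k * zeta i k $ c\<bar>"
            unfolding abs_mult by (rule mult_right_mono) simp
          then show "block_part own i y $ c * (\<Sum>k<K. alpha i k * zeta i k $ c)
              \<le> R * \<bar>\<Sum>k<K. alpha i k * zeta i k $ c\<bar>" by linarith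
        qed
        finally show ?thesis by (simp add: sum_distrib_left)
      qed
      have 5: "2 * R * R * (A * Ae) * (\<Sum>k<K. (real k + 1) powr (- (a + b)))
          \<le> 2 * R * R * (A * Ae) * (real K powr (1 - (a + b)) / (1 - (a + b)))"
        using ab R A Ae by (intro mult_left_mono sum_powr_neg_le) auto
      have "(\<Sum>k<K. alpha i0 k * t i k) \<le> (\<Sum>k<K. alpha i k * ((x i k - block_part own i y) \<bullet> g i k)
        + 2 * R * B * (alpha i0 k - alpha i k) + 2 * R * L * A * ((real k + 1) powr (- a) * disagreement v k)
        - alpha i k * (x i k \<bullet> zeta i k) + alpha i k * (block_part own i y \<bullet> zeta i k)
        + 2 * R * R * (A * Ae) * (real k + 1) powr (- (a + b)))"
        by (intro sum_mono point)
      also have "\<dots> = (\<Sum>k<K. alpha i k * ((x i k - block_part own i y) \<bullet> g i k))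
        + 2 * R * B * (\<Sum>k<K. alpha i0 k - alpha i k)
        + 2 * R * L * A * (\<Sum>k<K. (real k + 1) powr (- a) * disagreement v k)
        - (\<Sum>k<K. alpha i k * (x i k \<bullet> zeta i k)) + (\<Sum>k<K. alpha i k * (block_part own i y \<bullet> zeta i k))
        + 2 * R * R * (A * Ae) * (\<Sum>k<K. (real k + 1) powr (- (a + b)))"
        by (simp only: sum.distrib sum_subtractf sum_distrib_left right_diff_distrib)
      finally show ?thesis using 1 2 3 4 5 unfolding C_def by (simp add: diff_diff_eq)
    qed
    have "(\<Sum>k<K. alpha i0 k * ((s k - y) \<bullet> phi y)) \<le> (\<Sum>k<K. alpha i0 k * (\<Sum>i\<in>UNIV. t i k))"
    proof (intro sum_mono mult_left_mono)
      fix k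
      have "block_part own i (s k) = x i k" for i unfolding s_def by (rule block_part_run[OF run])
      then have "(\<Sum>i\<in>UNIV. t i k) = (\<Sum>i\<in>UNIV. block_part own i (s k - y) \<bullet>
          F i (block_part own i (s k)) (aggregate own h (s k)))"
        unfolding t_def by (simp add: linear_diff[OF bounded_linear.linear[OF bounded_linear_block_part]])
      also have "\<dots> = (s k - y) \<bullet> phi (s k)" unfolding phi_def by (rule sum_inner_block_part)
      finally show "(s k - y) \<bullet> phi y \<le> (\<Sum>i\<in>UNIV. t i k)"
        using phi_monotone[OF run_joint[OF run, of k] y] unfolding s_def
        by (simp add: inner_diff inner_commute)
    qed (use alpha_pos[of i0] in \<open>auto intro: less_imp_le\<close>)
    also have "\<dots> = (\<Sum>i\<in>UNIV. \<Sum>k<K. alpha i0 k * t i k)"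
      unfolding sum_distrib_left by (rule sum.swap)
    also have "\<dots> \<le> (\<Sum>i\<in>UNIV. C
        - (\<Sum>k<K. alpha i k * (x i k \<bullet> zeta i k)) + R * (\<Sum>c\<in>UNIV. \<bar>\<Sum>k<K. alpha i k * zeta i k $ c\<bar>)
        + (2 * R * R * (A * Ae) / (1 - (a + b))) * real K powr (1 - a - b))"
      by (intro sum_mono each)
    also have "\<dots> = CARD('n) * C - (\<Sum>i\<in>UNIV. \<Sum>k<K. alpha i k * (x i k \<bullet> zeta i k))
        + R * (\<Sum>i\<in>UNIV. \<Sum>c\<in>UNIV. \<bar>\<Sum>k<K. alpha i k * zeta i k $ c\<bar>) + C2 * real K powr (1 - a - b)"
      unfolding C2_def
      by (simp only: sum.distrib sum_subtractf sum_distrib_left[symmetric] sum_constant mult_ac)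
    also have "\<dots> \<le> C1 + noise R x zeta K + C2 * real K powr (1 - a - b)"
      unfolding C1_def noise_def
      using sum.swap[of "\<lambda>i k. alpha i k * (x i k \<bullet> zeta i k)" "{..<K}" UNIV] by linarith
    finally show ?thesis unfolding i0(1) s_def .
  qed
  have "0 < C1" "0 < C2" unfolding C1_def C2_def using R A Ae ab by auto
  then show thesis using R regret by (rule that)
qed

lemma gap_bound:
  obtains C1 C2 C3 R where "0 < C1" "0 < C2" "0 < C3" "0 < R"
    "\<And>i u. u \<in> X i \<Longrightarrow> norm u \<le> R"
    "\<And>x v vhat zeta K. run x v vhat zeta \<Longrightarrow> 0 < K \<Longrightarrow>
      gap (joint_set own X) phi
        (weighted_average (\<lambda>p. MAX i. alpha i p) (\<lambda>p. stack own (\<lambda>i. x i p)) K)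
        \<le> (C1 + C3 * noise R x zeta K) * real K powr (a - 1) + C2 * real K powr (- b)"
proof -
  obtain C1 C2 R where C: "0 < C1" "0 < C2" "0 < R" "\<And>i u. u \<in> X i \<Longrightarrow> norm u \<le> R"
    and regret: "\<And>x v vhat zeta K y. run x v vhat zeta \<Longrightarrow> y \<in> joint_set own X \<Longrightarrow>
      (\<Sum>k<K. (MAX i. alpha i k) * ((stack own (\<lambda>i. x i k) - y) \<bullet> phi y))
        \<le> C1 + noise R x zeta K + C2 * real K powr (1 - a - b)" using weighted_regret by blast
  obtain i0 where i0: "\<And>k. (MAX i. alpha i k) = alpha i0 k" and "\<And>i. lam i0 \<le> lam i"
    using alpha_Max by blast
  define c where "c = (1 + lam i0) powr (- a)"
  have c: "0 < c" unfolding c_def using lam_pos[of i0] by simp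
  have "gap (joint_set own X) phi
        (weighted_average (\<lambda>p. MAX i. alpha i p) (\<lambda>p. stack own (\<lambda>i. x i p)) K)
        \<le> (C1 / c + (1 / c) * noise R x zeta K) * real K powr (a - 1) + (C2 / c) * real K powr (- b)"
    if run: "run x v vhat zeta" and K: "0 < K" for x v vhat zeta K
    unfolding gap_def
  proof (rule cSUP_least)
    show "joint_set own X \<noteq> {}" using run_joint[OF run] by blast
    fix y assume y: "y \<in> joint_set own X"
    define w where "w = (\<Sum>p<K. alpha i0 p)"
    let ?s = "\<lambda>p. stack own (\<lambda>i. x i p)"
    have w: "c * real K powr (1 - a) \<le> w"
      unfolding w_def c_def alpha_def using ab K lam_pos[of i0] by (intro sum_powr_neg_ge) auto
    have cK: "0 < c * real K powr (1 - a)" using c K by simp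
    then have w0: "0 < w" using w by linarith
    define T where "T = C1 + noise R x zeta K + C2 * real K powr (1 - a - b)"
    \<comment> \<open>A nonnegative numerator is required because the weight sum \<open>w\<close>
      will be replaced by a lower bound.\<close>
    have noise: "0 \<le> noise R x zeta K" unfolding noise_def using C(3)
      by (intro add_nonneg_nonneg mult_nonneg_nonneg sum_nonneg) auto
    then have T: "0 \<le> T" unfolding T_def using C by simp
    have "weighted_average (\<lambda>p. MAX i. alpha i p) ?s K - y = (1 / w) *\<^sub>R (\<Sum>p<K. alpha i0 p *\<^sub>R (?s p - y))"
      unfolding weighted_average_def i0 w_def[symmetric]
      using w0 by (simp add: scaleR_diff_right sum_subtractf scaleR_left.sum[symmetric] w_def[symmetric])
    then have "(weighted_average (\<lambda>p. MAX i. alpha i p) ?s K - y) \<bullet> phi y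
        = (\<Sum>p<K. alpha i0 p * ((?s p - y) \<bullet> phi y)) / w"
      by (simp add: inner_sum_left)
    also have "\<dots> \<le> T / w"
      using regret[OF run y, of K] w0 unfolding i0 T_def by (intro divide_right_mono) auto
    also have "\<dots> \<le> T / (c * real K powr (1 - a))"
      using w cK T by (intro divide_left_mono) auto
    also have "\<dots> = (T * real K powr (a - 1)) / c"
    proof -
      have "real K powr (a - 1) * real K powr (1 - a) = 1" using K by (simp add: powr_add[symmetric])
      then show ?thesis using c K by (simp add: field_simps)
    qed
    also have "\<dots> = (C1 / c + (1 / c) * noise R x zeta K) * real K powr (a - 1) + (C2 / c) * real K powr (- b)"
    proof -
      have "real K powr (1 - a - b) * real K powr (a - 1) = real K powr (- b)"
        by (simp add: powr_add[symmetric])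
      then show ?thesis unfolding T_def by (simp add: distrib_right add_divide_distrib mult.assoc)
    qed
    finally show "(weighted_average (\<lambda>p. MAX i. alpha i p) ?s K - y) \<bullet> phi y \<le>
      (C1 / c + (1 / c) * noise R x zeta K) * real K powr (a - 1) + (C2 / c) * real K powr (- b)" .
  qed
  then show thesis using C c by (intro that[of "C1 / c" "C2 / c" "1 / c" R]) auto
qed

section \<open>Expected noise and measurability of the iterates\<close>

text \<open>The terms with x, added over the players, form one martingale difference; each
  coordinate of each player's noise gives another. Their sizes are of order
  \<open>(real k + 1) powr (- a)\<close> with 2 a > 1, so \<open>Q\<close> can be independent of
  K.\<close>

lemma noise_expectation_bounded:
  fixes M :: "'w measure" and x zeta :: "'n \<Rightarrow> nat \<Rightarrow> 'w \<Rightarrow> real^'c"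
  assumes "prob_space M" and "0 \<le> R"
    and filtration: "\<And>k. subalgebra M (\<F> k)" "\<And>k. subalgebra (\<F> (Suc k)) (\<F> k)"
    and x_adapted: "\<And>i k. x i k \<in> borel_measurable (\<F> k)"
    and zeta_adapted: "\<And>i k. zeta i k \<in> borel_measurable (\<F> (Suc k))"
    and x_bound: "\<And>i k \<omega>. \<omega> \<in> space M \<Longrightarrow> norm (x i k \<omega>) \<le> R"
    and zeta_bound: "\<And>i k \<omega>. \<omega> \<in> space M \<Longrightarrow> norm (zeta i k \<omega>) \<le> upsilon i"
    and centred: "\<And>i k c. AE \<omega> in M. real_cond_exp M (\<F> k) (\<lambda>\<omega>. zeta i k \<omega> $ c) \<omega> = 0"
  obtains Q where "0 < Q"
    "\<And>K. integrable M (\<lambda>\<omega>. noise R (\<lambda>i k. x i k \<omega>) (\<lambda>i k. zeta i k \<omega>) K)"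
    "\<And>K. (\<integral>\<omega>. noise R (\<lambda>i k. x i k \<omega>) (\<lambda>i k. zeta i k \<omega>) K \<partial>M) \<le> Q"
proof -
  interpret prob_space M by fact
  obtain A Ae where A: "0 < A" "\<And>i k. alpha i k \<le> A * (real k + 1) powr (- a)"
    and "0 < Ae" "\<And>i k. eta i k \<le> Ae * (real k + 1) powr (- b)"
    using step_bounds by blast
  obtain S where S: "\<And>n. (\<Sum>k<n. ((real k + 1) powr (- a))\<^sup>2) \<le> S"
    using step_square_sum_bounded by blast
  have S0: "0 \<le> S" using S[of 0] by simp
  define U where "U = (\<Sum>i\<in>UNIV. \<bar>upsilon i\<bar>)"
  have U0: "0 \<le> U" unfolding U_def by (intro sum_nonneg) auto
  have zU: "norm (zeta i k \<omega>) \<le> U" if "\<omega> \<in> space M" for i k \<omega>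
  proof -
    have "\<bar>upsilon i\<bar> \<le> U" unfolding U_def by (rule member_le_sum) auto
    then show ?thesis using zeta_bound[OF that, of i k] by linarith
  qed
  have zc: "\<bar>zeta i k \<omega> $ c\<bar> \<le> U" if "\<omega> \<in> space M" for i k \<omega> c
    using component_le_norm_cart[of "zeta i k \<omega>" c] zU[OF that] by (rule order.trans)
  have xc: "\<bar>x i k \<omega> $ c\<bar> \<le> R" if "\<omega> \<in> space M" for i k \<omega> c
    using component_le_norm_cart[of "x i k \<omega>" c] x_bound[OF that] by (rule order.trans)
  have zeta_M [measurable]: "zeta i k \<in> borel_measurable M" for i k
    using measurable_from_subalg[OF filtration(1) zeta_adapted] .
  have nth [measurable]: "(\<lambda>w::real^'c. w $ c) \<in> borel_measurable borel" for c
    by (intro borel_measurable_continuous_onI continuous_intros)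
  have orth: "expectation (\<lambda>\<omega>. g \<omega> * zeta i k \<omega> $ c) = 0"
    if "g \<in> borel_measurable (\<F> k)" "\<And>\<omega>. \<omega> \<in> space M \<Longrightarrow> \<bar>g \<omega>\<bar> \<le> d" for g d i k c
    by (rule expectation_mult_centred_eq_0[OF filtration(1) _ that zc centred]) measurable
  have square_sum: "(\<Sum>k<K. (A * (real k + 1) powr (- a) * d)\<^sup>2) \<le> (A * d)\<^sup>2 * S" for d K
  proof -
    have "(\<Sum>k<K. (A * (real k + 1) powr (- a) * d)\<^sup>2) = (A * d)\<^sup>2 * (\<Sum>k<K. ((real k + 1) powr (- a))\<^sup>2)"
      unfolding sum_distrib_left by (simp add: power_mult_distrib mult_ac)
    then show ?thesis using mult_left_mono[OF S[of K], of "(A * d)\<^sup>2"] by simp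
  qed
  have step_bound: "\<bar>alpha i k * y\<bar> \<le> A * (real k + 1) powr (- a) * d" if "\<bar>y\<bar> \<le> d" for i k y d
    using A(2)[of i k] alpha_pos[of i k] A(1) that by (auto simp: abs_mult intro!: mult_mono)
  define D where "D k \<omega> = (\<Sum>i\<in>UNIV. alpha i k * (x i k \<omega> \<bullet> zeta i k \<omega>))" for k \<omega>
  have D_adapted: "D k \<in> borel_measurable (\<F> (Suc k))" for k
    unfolding D_def using measurable_from_subalg[OF filtration(2) x_adapted] zeta_adapted by measurable
  have D_bound: "\<bar>D k \<omega>\<bar> \<le> A * (real k + 1) powr (- a) * (CARD('n) * (R * U))"
    if "\<omega> \<in> space M" for k \<omega>
  proof -
    have "\<bar>x i k \<omega> \<bullet> zeta i k \<omega>\<bar> \<le> R * U" for i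
      using Cauchy_Schwarz_ineq2[of "x i k \<omega>" "zeta i k \<omega>"]
        mult_mono[OF x_bound[OF that, of i k] zU[OF that, of i k] \<open>0 \<le> R\<close> norm_ge_zero] by linarith
    then have "\<bar>D k \<omega>\<bar> \<le> (\<Sum>i\<in>(UNIV::'n set). A * (real k + 1) powr (- a) * (R * U))"
      unfolding D_def by (intro order.trans[OF sum_abs] sum_mono step_bound)
    then show ?thesis by (simp add: mult_ac)
  qed
  \<comment> \<open>\<open>x i k\<close> is bounded and known at time k, so its coordinates may be
    multiplied into the test function; what remains is orthogonality of the noise
    coordinates.\<close>
  have D_orth: "expectation (\<lambda>\<omega>. g \<omega> * D k \<omega>) = 0"
    if g: "g \<in> borel_measurable (\<F> k)" "\<And>\<omega>. \<omega> \<in> space M \<Longrightarrow> \<bar>g \<omega>\<bar> \<le> d" for g d k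
  proof -
    let ?T = "\<lambda>i c \<omega>. (g \<omega> * x i k \<omega> $ c) * zeta i k \<omega> $ c"
    have gx: "(\<lambda>\<omega>. g \<omega> * x i k \<omega> $ c) \<in> borel_measurable (\<F> k)" for i c
      using g(1) measurable_compose[OF x_adapted nth] by (rule borel_measurable_times)
    have gxd: "\<bar>g \<omega> * x i k \<omega> $ c\<bar> \<le> d * R" if "\<omega> \<in> space M" for i c \<omega>
      unfolding abs_mult using g(2)[OF that] xc[OF that] by (intro mult_mono) auto
    have int: "integrable M (?T i c)" for i c
    proof (rule integrable_const_bound[of _ "(d * R) * U"])
      have "\<bar>?T i c \<omega>\<bar> \<le> (d * R) * U" if "\<omega> \<in> space M" for \<omega>
        unfolding abs_mult[of "g \<omega> * x i k \<omega> $ c"] using gxd[OF that, of i c] zc[OF that]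
        by (intro mult_mono) auto
      then show "AE \<omega> in M. norm (?T i c \<omega>) \<le> (d * R) * U" by auto
      show "?T i c \<in> borel_measurable M"
        using measurable_from_subalg[OF filtration(1) gx[of i c]] by measurable
    qed
    have "expectation (\<lambda>\<omega>. g \<omega> * D k \<omega>) = expectation (\<lambda>\<omega>. \<Sum>i\<in>UNIV. \<Sum>c\<in>UNIV. alpha i k * ?T i c \<omega>)"
      unfolding D_def inner_vec_def by (simp add: sum_distrib_left mult_ac)
    also have "\<dots> = (\<Sum>i\<in>UNIV. \<Sum>c\<in>UNIV. alpha i k * expectation (?T i c))"
      using int by simp
    also have "\<dots> = 0" using orth[OF gx gxd] by simp
    finally show ?thesis .
  qed
  have Z_adapted: "(\<lambda>\<omega>. alpha i k * zeta i k \<omega> $ c) \<in> borel_measurable (\<F> (Suc k))" for i k c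
    using zeta_adapted[of i k] by measurable
  have Z_orth: "expectation (\<lambda>\<omega>. g \<omega> * (alpha i k * zeta i k \<omega> $ c)) = 0"
    if "g \<in> borel_measurable (\<F> k)" "\<And>\<omega>. \<omega> \<in> space M \<Longrightarrow> \<bar>g \<omega>\<bar> \<le> d" for g d i k c
    using orth[OF that, of i c] by (simp add: mult.left_commute[of _ "alpha i k"])
  have D_moment: "integrable M (\<lambda>\<omega>. \<bar>\<Sum>k<K. D k \<omega>\<bar>)"
    "expectation (\<lambda>\<omega>. \<bar>\<Sum>k<K. D k \<omega>\<bar>) \<le> 1 + (A * (CARD('n) * (R * U)))\<^sup>2 * S" for K
  proof -
    note moment = orthogonal_increments_first_moment[where \<F> = \<F> and D = D
      and b = "\<lambda>k. A * (real k + 1) powr (- a) * (CARD('n) * (R * U))",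
      OF filtration D_adapted D_bound]
    show "integrable M (\<lambda>\<omega>. \<bar>\<Sum>k<K. D k \<omega>\<bar>)"
      by (rule moment(1)) (assumption, rule D_orth, assumption, blast)
    show "expectation (\<lambda>\<omega>. \<bar>\<Sum>k<K. D k \<omega>\<bar>) \<le> 1 + (A * (CARD('n) * (R * U)))\<^sup>2 * S"
      by (rule order.trans[OF moment(2) add_left_mono[OF square_sum]]) (assumption, rule D_orth, assumption, blast)
  qed
  have Z_moment: "integrable M (\<lambda>\<omega>. \<bar>\<Sum>k<K. alpha i k * zeta i k \<omega> $ c\<bar>)"
    "expectation (\<lambda>\<omega>. \<bar>\<Sum>k<K. alpha i k * zeta i k \<omega> $ c\<bar>) \<le> 1 + (A * U)\<^sup>2 * S" for i c K
  proof -
    note moment = orthogonal_increments_first_moment[where \<F> = \<F>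
      and D = "\<lambda>k \<omega>. alpha i k * zeta i k \<omega> $ c" and b = "\<lambda>k. A * (real k + 1) powr (- a) * U",
      OF filtration Z_adapted step_bound[OF zc]]
    show "integrable M (\<lambda>\<omega>. \<bar>\<Sum>k<K. alpha i k * zeta i k \<omega> $ c\<bar>)"
      by (rule moment(1)) (assumption, rule Z_orth, assumption, blast)
    show "expectation (\<lambda>\<omega>. \<bar>\<Sum>k<K. alpha i k * zeta i k \<omega> $ c\<bar>) \<le> 1 + (A * U)\<^sup>2 * S"
      by (rule order.trans[OF moment(2) add_left_mono[OF square_sum]]) (assumption, rule Z_orth, assumption, blast)
  qed
  define Q where "Q = 1 + (A * (CARD('n) * (R * U)))\<^sup>2 * S
    + R * (\<Sum>i\<in>(UNIV::'n set). \<Sum>c\<in>(UNIV::'c set). 1 + (A * U)\<^sup>2 * S)"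
  have noise_eq: "noise R (\<lambda>i k. x i k \<omega>) (\<lambda>i k. zeta i k \<omega>) K = \<bar>\<Sum>k<K. D k \<omega>\<bar>
    + R * (\<Sum>i\<in>UNIV. \<Sum>c\<in>UNIV. \<bar>\<Sum>k<K. alpha i k * zeta i k \<omega> $ c\<bar>)" for K \<omega>
    by (simp add: noise_def D_def)
  have int: "integrable M (\<lambda>\<omega>. noise R (\<lambda>i k. x i k \<omega>) (\<lambda>i k. zeta i k \<omega>) K)" for K
    unfolding noise_eq 
    by (intro Bochner_Integration.integrable_add integrable_mult_right
        Bochner_Integration.integrable_sum D_moment Z_moment)
  have "(\<integral>\<omega>. noise R (\<lambda>i k. x i k \<omega>) (\<lambda>i k. zeta i k \<omega>) K \<partial>M) \<le> Q" for K
  proof -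
    have "(\<integral>\<omega>. noise R (\<lambda>i k. x i k \<omega>) (\<lambda>i k. zeta i k \<omega>) K \<partial>M) = expectation (\<lambda>\<omega>. \<bar>\<Sum>k<K. D k \<omega>\<bar>)
      + R * (\<Sum>i\<in>UNIV. \<Sum>c\<in>UNIV. expectation (\<lambda>\<omega>. \<bar>\<Sum>k<K. alpha i k * zeta i k \<omega> $ c\<bar>))"
      unfolding noise_eq using D_moment(1) Z_moment(1) by simp
    also have "\<dots> \<le> Q" unfolding Q_def
      by (intro add_mono mult_left_mono sum_mono D_moment Z_moment \<open>0 \<le> R\<close>)
    finally show ?thesis .
  qed
  moreover have "0 < Q" unfolding Q_def using S0 \<open>0 \<le> R\<close>
    by (intro add_pos_nonneg mult_nonneg_nonneg sum_nonneg) auto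
  ultimately show thesis using int that by blast
qed

text \<open>The iterate at k involves the noise up to k - 1, hence the offset by one between x and
  \<open>zeta\<close>. The estimates v must accompany x in the induction because each update uses
  them.\<close>

lemma run_adapted:
  fixes x v vhat zeta :: "'n \<Rightarrow> nat \<Rightarrow> 'w \<Rightarrow> real^'c"
  assumes run: "\<And>\<omega>. \<omega> \<in> space M \<Longrightarrow>
      run (\<lambda>i k. x i k \<omega>) (\<lambda>i k. v i k \<omega>) (\<lambda>i k. vhat i k \<omega>) (\<lambda>i k. zeta i k \<omega>)"
    and filtration: "\<And>k. subalgebra M (\<F> k)" "\<And>k. subalgebra (\<F> (Suc k)) (\<F> k)"
    and x0: "\<And>i. x i 0 \<in> borel_measurable (\<F> 0)"
    and zeta: "\<And>i k. zeta i k \<in> borel_measurable (\<F> (Suc k))"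
    and h: "\<And>i. continuous_on UNIV (\<lambda>y. h i (block_part own i y))"
    and F: "\<And>i. continuous_on (X i \<times> UNIV) (\<lambda>(u, z). F i u z)"
  shows "x i k \<in> borel_measurable (\<F> k)"
proof -
  have space: "space (\<F> k) = space M" for k using filtration(1)[of k] by (simp add: subalgebra_def)
  \<comment> \<open>\<open>h i\<close> is given as continuous after composition with
    \<open>block_part\<close>; along a run both versions agree.\<close>
  have h_meas: "(\<lambda>\<omega>. h i (x i k \<omega>)) \<in> borel_measurable N"
    if "x i k \<in> borel_measurable N" "space N = space M" for N i k
  proof -
    have "(\<lambda>\<omega>. h i (block_part own i (x i k \<omega>))) \<in> borel_measurable N"
      using borel_measurable_continuous_onI[OF h] that(1) by (rule measurable_compose[rotated])
    then show ?thesis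
    proof (rule measurable_cong[THEN iffD1, rotated])
      fix \<omega> assume "\<omega> \<in> space N"
      then show "h i (block_part own i (x i k \<omega>)) = h i (x i k \<omega>)"
        using run_in_X[OF run, of \<omega> i k] X_block[of i] that(2) block_part_id by (metis subsetD)
    qed
  qed
  \<comment> \<open>Continuity of \<open>F i\<close> is given on \<open>X i \<times> UNIV\<close>,
    so the pair is regarded as a map into the Borel space restricted to that set.\<close>
  have F_meas: "(\<lambda>\<omega>. F i (x i k \<omega>) (z \<omega>)) \<in> borel_measurable N"
    if "x i k \<in> borel_measurable N" "space N = space M" "z \<in> borel_measurable N" for N i k z
  proof -
    have "(\<lambda>\<omega>. (x i k \<omega>, z \<omega>)) \<in> measurable N (restrict_space borel (X i \<times> UNIV))"
      using that run_in_X[OF run] by (intro measurable_restrict_space2 borel_measurable_Pair) auto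
    from measurable_compose[OF this borel_measurable_continuous_on_restrict[OF F]]
    show ?thesis by simp
  qed
  have "\<forall>i. x i k \<in> borel_measurable (\<F> k) \<and> v i k \<in> borel_measurable (\<F> k)"
  proof (induction k)
    case 0
    have "v i 0 \<in> borel_measurable (\<F> 0)" for i
      by (rule measurable_cong[THEN iffD1, rotated, OF h_meas[OF x0 space]])
        (use run in \<open>simp add: space run_def\<close>)
    then show ?case using x0 by simp
  next
    case (Suc k)
    have x [measurable]: "x i k \<in> borel_measurable (\<F> (Suc k))"
      and v [measurable]: "v i k \<in> borel_measurable (\<F> (Suc k))" for i
      using Suc measurable_from_subalg[OF filtration(2)] by blast+
    have "(\<lambda>\<omega>. \<Sum>j\<in>{j. (j, i) \<in> E k}. W k $ i $ j *\<^sub>R v j k \<omega>) \<in> borel_measurable (\<F> (Suc k))" for i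
      by measurable
    then have vhat [measurable]: "vhat i k \<in> borel_measurable (\<F> (Suc k))" for i
      by (rule measurable_cong[THEN iffD1, rotated]) (use run in \<open>simp add: space run_def\<close>)
    have zeta' [measurable]: "zeta i k \<in> borel_measurable (\<F> (Suc k))" for i by (rule zeta)
    have [measurable]: "(\<lambda>\<omega>. F i (x i k \<omega>) (real CARD('n) *\<^sub>R vhat i k \<omega>)) \<in> borel_measurable (\<F> (Suc k))" for i
      by (rule F_meas[OF x space]) measurable
    have "(\<lambda>\<omega>. x i k \<omega> - alpha i k *\<^sub>R (F i (x i k \<omega>) (real CARD('n) *\<^sub>R vhat i k \<omega>) + zeta i k \<omega>
        + eta i k *\<^sub>R x i k \<omega>)) \<in> borel_measurable (\<F> (Suc k))" for i by measurable
    from measurable_compose[OF this borel_measurable_continuous_onI[OF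
          continuous_on_closest_point[OF X_convex X_closed X_nonempty]]]
    have x': "x i (Suc k) \<in> borel_measurable (\<F> (Suc k))" for i
      by (rule measurable_cong[THEN iffD1, rotated]) (use run in \<open>simp add: space run_def\<close>)
    have [measurable]: "(\<lambda>\<omega>. h i (x i (Suc k) \<omega>)) \<in> borel_measurable (\<F> (Suc k))"
      "(\<lambda>\<omega>. h i (x i k \<omega>)) \<in> borel_measurable (\<F> (Suc k))" for i
      by (rule h_meas[OF _ space], rule x' x)+
    have "(\<lambda>\<omega>. vhat i k \<omega> + h i (x i (Suc k) \<omega>) - h i (x i k \<omega>)) \<in> borel_measurable (\<F> (Suc k))" for i
      by measurable
    then have "v i (Suc k) \<in> borel_measurable (\<F> (Suc k))" for i
      by (rule measurable_cong[THEN iffD1, rotated]) (use run in \<open>simp add: space run_def\<close>)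
    then show ?case using x' by blast
  qed
  then show ?thesis by blast
qed

end

section \<open>The probability bound for the gap\<close>

theorem corollary3:
  fixes M :: "'w measure"
    and own :: "'c::finite \<Rightarrow> 'n::finite"
    and sown :: "'d::finite \<Rightarrow> 'n"
    and X :: "'n \<Rightarrow> (real^'c) set"
    and h :: "'n \<Rightarrow> real^'c \<Rightarrow> real^'c"
    and psi :: "'n \<Rightarrow> real^'c \<Rightarrow> real^'c \<Rightarrow> real^'d \<Rightarrow> real"
    and xi :: "'n \<Rightarrow> 'w \<Rightarrow> real^'d"
    and f :: "'n \<Rightarrow> real^'c \<Rightarrow> real^'c \<Rightarrow> real"
    and F :: "'n \<Rightarrow> real^'c \<Rightarrow> real^'c \<Rightarrow> real^'c"
    and q :: "'n \<Rightarrow> real^'c \<Rightarrow> real^'c \<Rightarrow> real^'d \<Rightarrow> real^'c"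
    and phi :: "real^'c \<Rightarrow> real^'c"
    and upsilon :: "'n \<Rightarrow> real"
    and E :: "nat \<Rightarrow> ('n \<times> 'n) set"
    and W :: "nat \<Rightarrow> real^'n^'n"
    and vsig :: real and P :: nat
    and a b :: real and lam del :: "'n \<Rightarrow> real"
    and alpha eta :: "'n \<Rightarrow> nat \<Rightarrow> real"
    and x v vhat zeta :: "'n \<Rightarrow> nat \<Rightarrow> 'w \<Rightarrow> real^'c"
    and xis :: "'n \<Rightarrow> nat \<Rightarrow> 'w \<Rightarrow> real^'d"
    and xjoint :: "nat \<Rightarrow> 'w \<Rightarrow> real^'c"
    and eps1 eps2 :: real
  \<comment> \<open>game\<close>
  assumes prob: "prob_space M"
    and h_C1: "\<And>i. C1_on UNIV (\<lambda>y. h i (block_part own i y))"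
    and xi_rv: "\<And>i. xi i \<in> borel_measurable M"
    and xi_range: "\<And>i \<omega>. \<omega> \<in> space M \<Longrightarrow> xi i \<omega> \<in> block sown i"
    and f_def: "\<And>i. f i = expected_cost M (psi i) (xi i)"
    and F_def: "\<And>i. F i = total_grad own i (h i) (f i)"
    and q_def: "\<And>i u z e. q i u z e = total_grad own i (h i) (\<lambda>u s. psi i u s e) u z"
    and phi_def: "\<And>y. phi y = stack own (\<lambda>i. F i (block_part own i y) (aggregate own h y))"
  \<comment> \<open>strategy sets\<close>
    and X_block: "\<And>i. X i \<subseteq> block own i"
    and X_closed: "\<And>i. closed (X i)"
    and X_compact: "\<And>i. compact (X i)"
    and X_convex: "\<And>i. convex (X i)"
  \<comment> \<open>costs\<close>
    and f_convex: "\<And>i y. (\<forall>j. j \<noteq> i \<longrightarrow> block_part own j y \<in> X j) \<Longrightarrow>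
          convex_on (X i) (\<lambda>u. f i u (h i u + aggregate_others own h i y))"
    and f_C1: "\<And>i. \<exists>U. open U \<and> X i \<times> UNIV \<subseteq> U \<and>
          (\<forall>(y, s)\<in>U. integrable M (\<lambda>\<omega>. psi i (block_part own i y) s (xi i \<omega>))) \<and>
          C1_on U (\<lambda>(y, s). f i (block_part own i y) s)"
  \<comment> \<open>pseudo-gradient\<close>
    and phi_lipschitz: "\<exists>L. L-lipschitz_on (joint_set own X) phi"
    and phi_monotone: "\<And>y y'. y \<in> joint_set own X \<Longrightarrow> y' \<in> joint_set own X \<Longrightarrow>
          (phi y - phi y') \<bullet> (y - y') \<ge> 0"
  \<comment> \<open>Lipschitz conditions\<close>
    and h_lipschitz: "\<And>i. \<exists>Lh. Lh-lipschitz_on (X i) (h i)"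
    and F_lipschitz: "\<And>i cz. cz > 0 \<Longrightarrow> \<exists>Lf. \<forall>u\<in>X i. \<forall>z1 z2. norm z1 \<le> cz \<longrightarrow> norm z2 \<le> cz \<longrightarrow>
          norm (F i u z1 - F i u z2) \<le> Lf * norm (z1 - z2)"
  \<comment> \<open>stochastic gradients\<close>
    and psi_diff: "\<And>i. \<exists>C. open C \<and> X i \<subseteq> C \<and>
          (\<forall>e\<in>block sown i. (\<lambda>(y, s). psi i (block_part own i y) s e) differentiable_on (C \<times> UNIV))"
    and q_unbiased: "\<And>i u z. u \<in> X i \<Longrightarrow> has_bochner_integral M (\<lambda>\<omega>. q i u z (xi i \<omega>)) (F i u z)"
    and upsilon_pos: "\<And>i. upsilon i > 0"
    and q_bound: "\<And>i u z e. u \<in> X i \<Longrightarrow> e \<in> block sown i \<Longrightarrow>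
          norm (q i u z e - F i u z) \<le> upsilon i"
  \<comment> \<open>network; \<open>(j, i) \<in> E k\<close>: player \<open>i\<close> receives information from \<open>j\<close>\<close>
    and E_self: "\<And>k i. (i, i) \<in> E k"
    and W_nonneg: "\<And>k i j. W k $ i $ j \<ge> 0"
    and W_pos_iff: "\<And>k i j. W k $ i $ j > 0 \<longleftrightarrow> (j, i) \<in> E k"
    and W_stochastic: "\<And>k. doubly_stochastic (W k)"
    and vsig: "0 < vsig" "vsig < 1"
    and W_lower: "\<And>k i j. (j, i) \<in> E k \<Longrightarrow> W k $ i $ j \<ge> vsig"
    and P_pos: "P > 0"
    and E_connected: "\<And>k. strongly_connected (\<Union>l\<in>{1..P}. E (k + l))"
  \<comment> \<open>step sizes and regularization parameters\<close>
    and lam_pos: "\<And>i. lam i > 0" and del_pos: "\<And>i. del i > 0"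
    and ab: "1/2 < a" "a < 1" "b < a" "0 < b" "a + b < 1"
    and alpha_def: "\<And>i k. alpha i k = (real k + lam i) powr (- a)"
    and eta_def: "\<And>i k. eta i k = (real k + del i) powr (- b)"
  \<comment> \<open>algorithm\<close>
    and x0_rv: "\<And>i. x i 0 \<in> borel_measurable M"
    and x0_in: "\<And>i \<omega>. \<omega> \<in> space M \<Longrightarrow> x i 0 \<omega> \<in> X i"
    and v0: "\<And>i \<omega>. \<omega> \<in> space M \<Longrightarrow> v i 0 \<omega> = h i (x i 0 \<omega>)"
    and vhat_def: "\<And>i k \<omega>. \<omega> \<in> space M \<Longrightarrow>
          vhat i k \<omega> = (\<Sum>j\<in>{j. (j, i) \<in> E k}. W k $ i $ j *\<^sub>R v j k \<omega>)"
    and x_step: "\<And>i k \<omega>. \<omega> \<in> space M \<Longrightarrow>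
          x i (Suc k) \<omega> = closest_point (X i)
            (x i k \<omega> - alpha i k *\<^sub>R (q i (x i k \<omega>) (real CARD('n) *\<^sub>R vhat i k \<omega>) (xis i k \<omega>)
                                       + eta i k *\<^sub>R x i k \<omega>))"
    and v_step: "\<And>i k \<omega>. \<omega> \<in> space M \<Longrightarrow>
          v i (Suc k) \<omega> = vhat i k \<omega> + h i (x i (Suc k) \<omega>) - h i (x i k \<omega>)"
    and xjoint_def: "\<And>k \<omega>. xjoint k \<omega> = stack own (\<lambda>i. x i k \<omega>)"
  \<comment> \<open>sampling\<close>
    and xis_rv: "\<And>i k. xis i k \<in> borel_measurable M"
    and xis_range: "\<And>i k \<omega>. \<omega> \<in> space M \<Longrightarrow> xis i k \<omega> \<in> block sown i"
    and xis_distr: "\<And>i k. distr M borel (xis i k) = distr M borel (xi i)"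
    and zeta_def: "\<And>i k \<omega>. zeta i k \<omega> =
          q i (x i k \<omega>) (real CARD('n) *\<^sub>R vhat i k \<omega>) (xis i k \<omega>)
          - F i (x i k \<omega>) (real CARD('n) *\<^sub>R vhat i k \<omega>)"
    and zeta_rv: "\<And>i k. zeta i k \<in> borel_measurable M"
    and zeta_mean: "\<And>i k c. AE \<omega> in M.
          real_cond_exp M (past_algebra M (xjoint 0) zeta k) (\<lambda>\<omega>. zeta i k \<omega> $ c) \<omega> = 0"
    and zeta_bound: "\<And>i k \<omega>. \<omega> \<in> space M \<Longrightarrow> norm (zeta i k \<omega>) \<le> upsilon i"
  \<comment> \<open>confidence levels\<close>
    and eps: "0 < eps1" "eps1 \<le> 1" "0 < eps2" "eps2 \<le> 1"
  shows "\<exists>Cg1 Cg2 Cg3 Cg4. 0 < Cg1 \<and> 0 < Cg2 \<and> 0 < Cg3 \<and> 0 < Cg4 \<and>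
    (\<forall>K::nat. K > 0 \<longrightarrow>
      \<P>(\<omega> in M.
         gap (joint_set own X) phi
             (weighted_average (\<lambda>p. MAX i. alpha i p) (\<lambda>p. xjoint p \<omega>) K)
         \<ge> (Cg1 + Cg3 * sqrt (ln (1 / eps1)) + Cg4 * sqrt (ln (1 / eps2))) * real K powr (a - 1)
           + Cg2 * real K powr (- b))
      \<le> eps1 + eps2)"
proof -
  interpret prob_space M by (rule prob)
  \<comment> \<open>The initial point on this path witnesses that every strategy set is
    nonempty.\<close>
  obtain \<omega>0 where \<omega>0: "\<omega>0 \<in> space M" using not_empty by blast
  have F_regular: "continuous_on (X i \<times> UNIV) (\<lambda>(u, z). F i u z)"
    "\<And>u z. u \<in> X i \<Longrightarrow> F i u z \<in> block own i" for i
  proof -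
    obtain U where "X i \<times> UNIV \<subseteq> U" "C1_on U (\<lambda>(y, s). f i (block_part own i y) s)"
      using f_C1 by blast
    note regular = total_grad_regular[where h = "h i" and g = "f i", OF h_C1 this X_block]
    show "continuous_on (X i \<times> UNIV) (\<lambda>(u, z). F i u z)"
      unfolding F_def by (rule regular(1))
    show "F i u z \<in> block own i" if "u \<in> X i" for u z
      unfolding F_def by (rule regular(2)[OF that])
  qed
  have W_zero: "W k $ i $ j = 0" if "(j, i) \<notin> E k" for k i j
    using W_pos_iff[of k i j] W_nonneg[of k i j] that by linarith
  interpret game: aggregative_game E W vsig P own X h F phi upsilon a b lam del alpha eta
  proof
    show "X i \<noteq> {}" for i using x0_in[OF \<omega>0] by blast
    show "(\<Sum>j\<in>UNIV. W k $ i $ j) = 1" "(\<Sum>j\<in>UNIV. W k $ j $ i) = 1" for k i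
      using W_stochastic[of k] by (simp_all add: doubly_stochastic_def)
  qed (fact E_self W_nonneg W_lower vsig E_connected W_zero P_pos phi_def X_block X_compact X_convex
      phi_lipschitz phi_monotone h_lipschitz F_lipschitz F_regular(2) lam_pos del_pos ab alpha_def eta_def)+
  have run: "game.run (\<lambda>i k. x i k \<omega>) (\<lambda>i k. v i k \<omega>) (\<lambda>i k. vhat i k \<omega>) (\<lambda>i k. zeta i k \<omega>)"
    if "\<omega> \<in> space M" for \<omega>
  proof -
    have "x i (Suc k) \<omega> = closest_point (X i) (x i k \<omega> - alpha i k *\<^sub>R
        (F i (x i k \<omega>) (real CARD('n) *\<^sub>R vhat i k \<omega>) + zeta i k \<omega> + eta i k *\<^sub>R x i k \<omega>))" for i k
      unfolding x_step[OF that] zeta_def by simp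
    then show ?thesis unfolding game.run_def
      using x0_in[OF that] v0[OF that] vhat_def[OF that] v_step[OF that] zeta_bound[OF that] by blast
  qed
  define \<F> where "\<F> = past_algebra M (xjoint 0) zeta"
  have xjoint0: "xjoint 0 \<in> borel_measurable M"
  proof -
    have "xjoint 0 = (\<lambda>\<omega>. \<Sum>i\<in>UNIV. block_part own i (x i 0 \<omega>))"
      by (simp add: fun_eq_iff xjoint_def stack_def vec_eq_iff block_part_def)
    moreover have "(\<lambda>\<omega>. \<Sum>i\<in>UNIV. block_part own i (x i 0 \<omega>)) \<in> borel_measurable M"
      by (intro borel_measurable_sum measurable_compose[OF x0_rv] borel_measurable_continuous_onI
          linear_continuous_on bounded_linear_block_part)
    ultimately show ?thesis by simp
  qed
  have filtration: "subalgebra M (\<F> k)" "subalgebra (\<F> (Suc k)) (\<F> k)" for k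
    unfolding \<F>_def using subalgebra_past_algebra[where zeta = zeta, OF xjoint0 zeta_rv] past_algebra_mono[where zeta = zeta, OF xjoint0 zeta_rv]
    by blast+
  have zeta_adapted: "zeta i k \<in> borel_measurable (\<F> (Suc k))" for i k
    unfolding \<F>_def by (rule noise_measurable_past[where zeta = zeta, OF xjoint0 zeta_rv]) simp
  \<comment> \<open>The filtration is generated by the stacked initial point, from which each
    player's part is recovered by \<open>block_part\<close>.\<close>
  have x0_adapted: "x i 0 \<in> borel_measurable (\<F> 0)" for i
  proof (rule measurable_cong[THEN iffD1])
    show "(\<lambda>\<omega>. block_part own i (xjoint 0 \<omega>)) \<in> borel_measurable (\<F> 0)"
      unfolding \<F>_def
      by (intro measurable_compose[OF initial_measurable_past[where zeta = zeta, OF xjoint0 zeta_rv]]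
          borel_measurable_continuous_onI linear_continuous_on bounded_linear_block_part)
    fix \<omega> assume "\<omega> \<in> space (\<F> 0)"
    then have "\<omega> \<in> space M" using filtration(1)[of 0] by (simp add: subalgebra_def)
    then show "block_part own i (xjoint 0 \<omega>) = x i 0 \<omega>"
      unfolding xjoint_def using x0_in X_block by (intro block_part_stack) blast
  qed
  have h_cont: "continuous_on UNIV (\<lambda>y. h i (block_part own i y))" for i
    by (rule C1_on_imp_continuous_on[OF h_C1])
  have x_adapted: "x i k \<in> borel_measurable (\<F> k)" for i k
    by (rule game.run_adapted[OF run filtration x0_adapted zeta_adapted h_cont F_regular(1)])
  obtain C1 C2 C3 R where C: "0 < C1" "0 < C2" "0 < C3" and R: "0 < R"
    "\<And>i u. u \<in> X i \<Longrightarrow> norm u \<le> R"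
    and gap: "\<And>x v vhat zeta K. game.run x v vhat zeta \<Longrightarrow> 0 < K \<Longrightarrow>
      gap (joint_set own X) phi
        (weighted_average (\<lambda>p. MAX i. alpha i p) (\<lambda>p. stack own (\<lambda>i. x i p)) K)
        \<le> (C1 + C3 * game.noise R x zeta K) * real K powr (a - 1) + C2 * real K powr (- b)"
    using game.gap_bound by blast
  define N where "N K \<omega> = game.noise R (\<lambda>i k. x i k \<omega>) (\<lambda>i k. zeta i k \<omega>) K" for K \<omega>
  obtain Q where Q: "0 < Q" "\<And>K. integrable M (N K)" "\<And>K. expectation (N K) \<le> Q"
  proof (rule game.noise_expectation_bounded[where \<F> = \<F> and x = x and zeta = zeta,
      OF prob less_imp_le[OF R(1)] filtration x_adapted zeta_adapted])
    show "norm (x i k \<omega>) \<le> R" if "\<omega> \<in> space M" for i k \<omega>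
      by (rule R(2)[OF game.run_in_X[OF run[OF that]]])
    show "AE \<omega> in M. real_cond_exp M (\<F> k) (\<lambda>\<omega>. zeta i k \<omega> $ c) \<omega> = 0" for i k c
      unfolding \<F>_def by (rule zeta_mean)
  qed (use zeta_bound that in \<open>auto simp: N_def[abs_def]\<close>)
  \<comment> \<open>Chosen so that Markov's bound \<open>Q / t\<close> equals \<open>eps1\<close>;
    the level t then becomes part of the first constant.\<close>
  define t where "t = Q / eps1"
  have t: "0 < t" unfolding t_def using Q eps by simp
  have N_nonneg: "0 \<le> N K \<omega>" for K \<omega>
    unfolding N_def game.noise_def using R
    by (intro add_nonneg_nonneg mult_nonneg_nonneg sum_nonneg) auto
  have tail: "prob {\<omega> \<in> space M. t \<le> N K \<omega>} \<le> eps1" for K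
  proof -
    have "prob {\<omega> \<in> space M. t \<le> N K \<omega>} \<le> expectation (N K) / t"
      using Q(2) t N_nonneg by (intro integral_Markov_inequality_measure[where A = "space M"]) auto
    also have "\<dots> \<le> Q / t" using Q(3) t by (intro divide_right_mono) auto
    finally show ?thesis unfolding t_def using Q eps by simp
  qed
  \<comment> \<open>As \<open>eps1\<close> and \<open>eps2\<close> are at most 1, both logarithmic
    terms are nonnegative and only raise the threshold; the coefficient 1 is an arbitrary positive
    choice.\<close>
  have "prob {\<omega> \<in> space M. (C1 + C3 * t + 1 * sqrt (ln (1 / eps1)) + 1 * sqrt (ln (1 / eps2))) * real K powr (a - 1)
      + C2 * real K powr (- b)
      \<le> gap (joint_set own X) phi (weighted_average (\<lambda>p. MAX i. alpha i p) (\<lambda>p. xjoint p \<omega>) K)}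
      \<le> eps1 + eps2" if K: "0 < K" for K :: nat
  proof -
    have "t \<le> N K \<omega>" if \<omega>: "\<omega> \<in> space M"
      and large: "(C1 + C3 * t + 1 * sqrt (ln (1 / eps1)) + 1 * sqrt (ln (1 / eps2))) * real K powr (a - 1)
      + C2 * real K powr (- b)
      \<le> gap (joint_set own X) phi (weighted_average (\<lambda>p. MAX i. alpha i p) (\<lambda>p. xjoint p \<omega>) K)" for \<omega>
    proof -
      have "0 \<le> sqrt (ln (1 / eps1))" "0 \<le> sqrt (ln (1 / eps2))" using eps by simp_all
      then have "(C1 + C3 * t) * real K powr (a - 1)
          \<le> (C1 + C3 * t + 1 * sqrt (ln (1 / eps1)) + 1 * sqrt (ln (1 / eps2))) * real K powr (a - 1)"
        by (intro mult_right_mono) auto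
      moreover have "gap (joint_set own X) phi (weighted_average (\<lambda>p. MAX i. alpha i p) (\<lambda>p. xjoint p \<omega>) K)
          \<le> (C1 + C3 * N K \<omega>) * real K powr (a - 1) + C2 * real K powr (- b)"
        unfolding xjoint_def N_def by (rule gap[OF run[OF \<omega>] K])
      ultimately have "(C1 + C3 * t) * real K powr (a - 1) \<le> (C1 + C3 * N K \<omega>) * real K powr (a - 1)"
        using large by linarith
      then show ?thesis using K C(3) by simp
    qed
    \<comment> \<open>Monotonicity of the measure asks for measurability of the larger event, which
      is a condition on the integrable function \<open>N K\<close>.\<close>
    then have "prob {\<omega> \<in> space M. (C1 + C3 * t + 1 * sqrt (ln (1 / eps1)) + 1 * sqrt (ln (1 / eps2))) * real K powr (a - 1)
      + C2 * real K powr (- b)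
      \<le> gap (joint_set own X) phi (weighted_average (\<lambda>p. MAX i. alpha i p) (\<lambda>p. xjoint p \<omega>) K)}
      \<le> prob {\<omega> \<in> space M. t \<le> N K \<omega>}"
      using borel_measurable_integrable[OF Q(2)[of K]]
      by (intro finite_measure_mono) (blast, measurable)
    then show ?thesis using tail[of K] eps by linarith
  qed
  moreover have "0 < C1 + C3 * t" using C t by (intro add_pos_pos mult_pos_pos)
  ultimately show ?thesis using C(2)
    by (intro exI[of _ "C1 + C3 * t"] exI[of _ C2] exI[of _ 1] conjI allI impI) auto
qed

end
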